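(* Let $\{(A_j,\rho_j): j\in J\}$ be a family of complete normal contact algebras, indexed by a set $J$. Then the pair $\bigoplus_{j\in J}(A_j,\rho_j)=(\tilde{A},\tilde{\rho})$ (constructed in the context) is a $\mathbf{DHC}$-sum of the family $\{(A_j,\rho_j): j\in J\}$, i.e. it is (the object of) a coproduct of this family in the category $\mathbf{DHC}$.
   Context: Boolean algebras have top $1$, bottom $0$ (possibly equal), complement $a^*$. **Contact algebras.** A contact algebra $(B,C)$ is a Boolean algebra $B$ with a binary relation $C$ such that: (C1) $a\neq 0\Rightarrow aCa$; (C2) $aCb\Rightarrow a\neq 0$ and $b\ne 0$; (C3) $aCb\Rightarrow bCa$; (C4) $aC(b\vee c)$ iff $aCb$ or $aCc$. Write $a(-C)b$ for "not $aCb$", and $a\ll_C b$ iff $a(-C)b^*$. It is a normal contact algebra (NCA) if also (C5) $a(-C)b$ implies $a(-C)c$ and $b(-C)c^*$ for some $c\in B$; (C6) if $a\neq 1$ there is $b\neq 0$ with $b(-C)a$. It is a complete normal contact algebra (CNCA) if moreover $B$ is a complete Boolean algebra. **The category $\mathbf{DHC}$.** Objects: CNCAs. Morphisms $\varphi:(A,C)\to(B,C')$: functions $\varphi:A\to B$ such that (DVAL1) $\varphi(0)=0$; (DVAL2) $\varphi(a\wedge b)=\varphi(a)\wedge\varphi(b)$ for all $a,b\in A$; (DVAL3) $a\ll_C b$ implies $(\varphi(a^* ))^*\ll_{C'}\varphi(b)$; (DVAL4) $\varphi(a)=\bigvee\{\varphi(b): b\ll_C a\}$ for all $a\in A$. Composition: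 $\varphi_2\diamond\varphi_1=(\varphi_2\circ\varphi_1)\check{}$, where for a function $\psi$ from $(A,C)$ to another object one sets $\psi\check{}(a)=\bigvee\{\psi(b): b\ll_C a\}$. **Construction of $\bigoplus_{j\in J}(A_j,\rho_j)$.** Let $(A,(\varphi_j)_{j\in J})$ be the sum (coproduct, free product) of the Boolean algebras $A_j$ in the category of Boolean algebras and Boolean homomorphisms, where $\varphi_j:A_j\to A$ is the canonical complete monomorphism for every $j\in J$, and let $\tilde{A}$ be the (MacNeille) completion of $A$, with $A\subseteq\tilde{A}$. Put $E=\{\bigwedge_{i\in I}\varphi_i(a_i): I\subseteq J,\ |I|<\aleph_0,\ a_i\in A_i\ \forall i\in I\}$. For every two elements $a=\bigwedge_{i\in I_1}\varphi_i(a_i)$ and $b=\bigwedge_{i\in I_2}\varphi_i(b_i)$ of $E$, put $a\tilde{\rho}b$ iff $a_i\rho_i b_i$ for all $i\in I_1\cap I_2$. Further, for every two elements $c,d\in\tilde{A}$, put $c(-\tilde{\rho})d$ iff there are $k,l\in\mathbb{N}^+$ and $c_1,\dots,c_k,d_1,\dots,d_l\in E$ with $c\le\bigvee_{i=1}^k c_i$, $d\le\bigvee_{j=1}^l d_j$ and $c_i(-\tilde{\rho})d_j$ for all $i=1,\dots,k$ and all $j=1,\dots,l$.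
   Formalization: Contact on the completion additionally requires both elements to be nonzero (this matters only for empty J, where otherwise 0 would be in contact with 0, against C2), and contact on E is required for all representations, since for 0 it depends on the representation. *)

theory Defs
  imports "HOL-Algebra.Complete_Lattice"
begin

section \<open>Boolean algebras with explicit carrier\<close>

locale boolean_lattice = bounded_lattice L for L (structure) +
  assumes meet_join_distrib:
      "\<lbrakk>x \<in> carrier L; y \<in> carrier L; z \<in> carrier L\<rbrakk>
        \<Longrightarrow> x \<sqinter> (y \<squnion> z) = (x \<sqinter> y) \<squnion> (x \<sqinter> z)"
    and complement_exists:
      "x \<in> carrier L \<Longrightarrow> \<exists>y\<in>carrier L. x \<sqinter> y = \<bottom> \<and> x \<squnion> y = \<top>"

locale complete_boolean_lattice = boolean_lattice L + complete_lattice L for L (structure)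

definition compl_in :: "('a, 'm) gorder_scheme \<Rightarrow> 'a \<Rightarrow> 'a" where
  "compl_in L x = (THE y. y \<in> carrier L \<and> x \<sqinter>\<^bsub>L\<^esub> y = \<bottom>\<^bsub>L\<^esub> \<and> x \<squnion>\<^bsub>L\<^esub> y = \<top>\<^bsub>L\<^esub>)"

text \<open>Maps out of a carrier are represented by functions that are \<open>undefined\<close> outside it,
  so that equality of homomorphisms is equality of functions.\<close>

definition ba_hom :: "'a gorder \<Rightarrow> 'b gorder \<Rightarrow> ('a \<Rightarrow> 'b) set" where
  "ba_hom A B = {h \<in> carrier A \<rightarrow>\<^sub>E carrier B.
     h \<bottom>\<^bsub>A\<^esub> = \<bottom>\<^bsub>B\<^esub> \<and> h \<top>\<^bsub>A\<^esub> = \<top>\<^bsub>B\<^esub> \<and>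
     (\<forall>x\<in>carrier A. \<forall>y\<in>carrier A.
        h (x \<sqinter>\<^bsub>A\<^esub> y) = h x \<sqinter>\<^bsub>B\<^esub> h y \<and> h (x \<squnion>\<^bsub>A\<^esub> y) = h x \<squnion>\<^bsub>B\<^esub> h y) \<and>
     (\<forall>x\<in>carrier A. h (compl_in A x) = compl_in B (h x))}"

text \<open>Coproduct cocones in the category of Boolean algebras and Boolean homomorphisms. HOL cannot
  quantify over types inside a formula, so the universal property is tested against the Boolean
  algebras carried by the type \<open>'t\<close>; a cocone is a coproduct if it passes the test at every type.
  A coproduct is already determined by two instances: the test at the type of \<open>S\<close> itself shows
  that \<open>S\<close> is generated by the images of the \<open>\<phi> j\<close>, and the test at \<open>bool\<close> (homomorphisms
  into the two-element algebra) shows that these images are independent (unless some \<open>A j\<close> is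
  trivial, and then \<open>S\<close> is trivial too).\<close>

definition ba_sum ::
  "'t itself \<Rightarrow> 'j set \<Rightarrow> ('j \<Rightarrow> 'a gorder) \<Rightarrow> 'b gorder \<Rightarrow> ('j \<Rightarrow> 'a \<Rightarrow> 'b) \<Rightarrow> bool" where
  "ba_sum TYPE('t) J A S \<phi> \<longleftrightarrow>
     boolean_lattice S \<and> (\<forall>j\<in>J. \<phi> j \<in> ba_hom (A j) S) \<and>
     (\<forall>(B :: 't gorder) f. boolean_lattice B \<longrightarrow> (\<forall>j\<in>J. f j \<in> ba_hom (A j) B) \<longrightarrow>
        (\<exists>!h. h \<in> ba_hom S B \<and> (\<forall>j\<in>J. compose (carrier (A j)) h (\<phi> j) = f j)))"

text \<open>\<open>T\<close> is the (MacNeille) completion of the Boolean algebra \<open>S\<close>: a complete Boolean algebra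
  containing \<open>S\<close> as a dense subalgebra.\<close>

definition ba_completion :: "'b gorder \<Rightarrow> 'b gorder \<Rightarrow> bool" where
  "ba_completion S T \<longleftrightarrow>
     complete_boolean_lattice T \<and> carrier S \<subseteq> carrier T \<and>
     (\<lambda>x\<in>carrier S. x) \<in> ba_hom S T \<and>
     (\<forall>x\<in>carrier T. x \<noteq> \<bottom>\<^bsub>T\<^esub> \<longrightarrow> (\<exists>s\<in>carrier S. s \<noteq> \<bottom>\<^bsub>T\<^esub> \<and> s \<sqsubseteq>\<^bsub>T\<^esub> x))"


section \<open>Contact algebras\<close>

locale contact_algebra = boolean_lattice B for B (structure) and C :: "'a \<Rightarrow> 'a \<Rightarrow> bool" +
  assumes C1: "\<lbrakk>a \<in> carrier B; a \<noteq> \<bottom>\<rbrakk> \<Longrightarrow> C a a"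
    and C2: "\<lbrakk>a \<in> carrier B; b \<in> carrier B; C a b\<rbrakk> \<Longrightarrow> a \<noteq> \<bottom> \<and> b \<noteq> \<bottom>"
    and C3: "\<lbrakk>a \<in> carrier B; b \<in> carrier B; C a b\<rbrakk> \<Longrightarrow> C b a"
    and C4: "\<lbrakk>a \<in> carrier B; b \<in> carrier B; c \<in> carrier B\<rbrakk>
               \<Longrightarrow> C a (b \<squnion> c) \<longleftrightarrow> C a b \<or> C a c"

locale normal_contact_algebra = contact_algebra +
  assumes C5: "\<lbrakk>a \<in> carrier B; b \<in> carrier B; \<not> C a b\<rbrakk>
               \<Longrightarrow> \<exists>c\<in>carrier B. \<not> C a c \<and> \<not> C b (compl_in B c)"
    and C6: "\<lbrakk>a \<in> carrier B; a \<noteq> \<top>\<rbrakk> \<Longrightarrow> \<exists>b\<in>carrier B. b \<noteq> \<bottom> \<and> \<not> C b a"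

locale cnca = normal_contact_algebra B C + complete_lattice B
  for B (structure) and C :: "'a \<Rightarrow> 'a \<Rightarrow> bool"

definition ll :: "'a gorder \<Rightarrow> ('a \<Rightarrow> 'a \<Rightarrow> bool) \<Rightarrow> 'a \<Rightarrow> 'a \<Rightarrow> bool" where
  "ll B C a b \<longleftrightarrow> \<not> C a (compl_in B b)"


section \<open>The category DHC\<close>

definition dhc_hom ::
  "'a gorder \<Rightarrow> ('a \<Rightarrow> 'a \<Rightarrow> bool) \<Rightarrow> 'b gorder \<Rightarrow> ('b \<Rightarrow> 'b \<Rightarrow> bool) \<Rightarrow> ('a \<Rightarrow> 'b) set" where
  "dhc_hom A C B C' = {f \<in> carrier A \<rightarrow>\<^sub>E carrier B.
     f \<bottom>\<^bsub>A\<^esub> = \<bottom>\<^bsub>B\<^esub> \<and>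
     (\<forall>a\<in>carrier A. \<forall>b\<in>carrier A. f (a \<sqinter>\<^bsub>A\<^esub> b) = f a \<sqinter>\<^bsub>B\<^esub> f b) \<and>
     (\<forall>a\<in>carrier A. \<forall>b\<in>carrier A.
        ll A C a b \<longrightarrow> ll B C' (compl_in B (f (compl_in A a))) (f b)) \<and>
     (\<forall>a\<in>carrier A. f a = \<Squnion>\<^bsub>B\<^esub> (f ` {b \<in> carrier A. ll A C b a}))}"

definition check ::
  "'a gorder \<Rightarrow> ('a \<Rightarrow> 'a \<Rightarrow> bool) \<Rightarrow> 'b gorder \<Rightarrow> ('a \<Rightarrow> 'b) \<Rightarrow> 'a \<Rightarrow> 'b" where
  "check A C B f = (\<lambda>a\<in>carrier A. \<Squnion>\<^bsub>B\<^esub> (f ` {b \<in> carrier A. ll A C b a}))"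

text \<open>\<open>dhc_comp A C D g f\<close> is the composition of \<open>f : (A, C) \<rightarrow> _\<close> and \<open>g : _ \<rightarrow> (D, _)\<close>;
  it does not depend on the contact relation of the codomain.\<close>

definition dhc_comp ::
  "'a gorder \<Rightarrow> ('a \<Rightarrow> 'a \<Rightarrow> bool) \<Rightarrow> 'd gorder \<Rightarrow> ('b \<Rightarrow> 'd) \<Rightarrow> ('a \<Rightarrow> 'b) \<Rightarrow> 'a \<Rightarrow> 'd" where
  "dhc_comp A C D g f = check A C D (compose (carrier A) g f)"

text \<open>The object \<open>(T, R)\<close> with the injections \<open>\<iota> j\<close> is a coproduct in DHC; as in \<open>ba_sum\<close>, the
  test objects of the universal property are those carried by the type \<open>'t\<close>.\<close>

definition dhc_sum ::
  "'t itself \<Rightarrow> 'j set \<Rightarrow> ('j \<Rightarrow> 'a gorder) \<Rightarrow> ('j \<Rightarrow> 'a \<Rightarrow> 'a \<Rightarrow> bool) \<Rightarrow>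
    'b gorder \<Rightarrow> ('b \<Rightarrow> 'b \<Rightarrow> bool) \<Rightarrow> ('j \<Rightarrow> 'a \<Rightarrow> 'b) \<Rightarrow> bool" where
  "dhc_sum TYPE('t) J A \<rho> T R \<iota> \<longleftrightarrow>
     cnca T R \<and> (\<forall>j\<in>J. \<iota> j \<in> dhc_hom (A j) (\<rho> j) T R) \<and>
     (\<forall>(B :: 't gorder) C f. cnca B C \<longrightarrow> (\<forall>j\<in>J. f j \<in> dhc_hom (A j) (\<rho> j) B C) \<longrightarrow>
        (\<exists>!h. h \<in> dhc_hom T R B C \<and> (\<forall>j\<in>J. dhc_comp (A j) (\<rho> j) B h (\<iota> j) = f j)))"


section \<open>The contact relation on the completed free product\<close>

definition box_index :: "'j set \<Rightarrow> ('j \<Rightarrow> 'a gorder) \<Rightarrow> ('j set \<times> ('j \<Rightarrow> 'a)) set" where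
  "box_index J A = {(I, x). finite I \<and> I \<subseteq> J \<and> x \<in> (\<Pi> i\<in>I. carrier (A i))}"

text \<open>The meet is computed in the completion \<open>T\<close>; this agrees with the meet in the subalgebra.\<close>

definition box :: "'b gorder \<Rightarrow> ('j \<Rightarrow> 'a \<Rightarrow> 'b) \<Rightarrow> 'j set \<times> ('j \<Rightarrow> 'a) \<Rightarrow> 'b" where
  "box T \<phi> = (\<lambda>(I, x). \<Sqinter>\<^bsub>T\<^esub> ((\<lambda>i. \<phi> i (x i)) ` I))"

definition boxes :: "'j set \<Rightarrow> ('j \<Rightarrow> 'a gorder) \<Rightarrow> 'b gorder \<Rightarrow> ('j \<Rightarrow> 'a \<Rightarrow> 'b) \<Rightarrow> 'b set" where
  "boxes J A T \<phi> = box T \<phi> ` box_index J A"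

text \<open>A nonzero box has a unique representation up to coordinates equal to \<open>\<top>\<close>, so for nonzero
  boxes it does not matter which representations are compared. The zero box has representations
  that give different answers (for instance through different coordinates); quantifying over
  all representations puts it in contact with nothing, as axiom \<open>C2\<close> requires.\<close>

definition box_contact ::
  "'j set \<Rightarrow> ('j \<Rightarrow> 'a gorder) \<Rightarrow> ('j \<Rightarrow> 'a \<Rightarrow> 'a \<Rightarrow> bool) \<Rightarrow> 'b gorder \<Rightarrow> ('j \<Rightarrow> 'a \<Rightarrow> 'b) \<Rightarrow>
    'b \<Rightarrow> 'b \<Rightarrow> bool" where
  "box_contact J A \<rho> T \<phi> a b \<longleftrightarrow>
     (\<forall>I\<^sub>1 x I\<^sub>2 y. (I\<^sub>1, x) \<in> box_index J A \<and> (I\<^sub>2, y) \<in> box_index J A \<and>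
        box T \<phi> (I\<^sub>1, x) = a \<and> box T \<phi> (I\<^sub>2, y) = b \<longrightarrow> (\<forall>i\<in>I\<^sub>1 \<inter> I\<^sub>2. \<rho> i (x i) (y i)))"

definition separated ::
  "'j set \<Rightarrow> ('j \<Rightarrow> 'a gorder) \<Rightarrow> ('j \<Rightarrow> 'a \<Rightarrow> 'a \<Rightarrow> bool) \<Rightarrow> 'b gorder \<Rightarrow> ('j \<Rightarrow> 'a \<Rightarrow> 'b) \<Rightarrow>
    'b \<Rightarrow> 'b \<Rightarrow> bool" where
  "separated J A \<rho> T \<phi> c d \<longleftrightarrow>
     (\<exists>F G. finite F \<and> F \<noteq> {} \<and> F \<subseteq> boxes J A T \<phi> \<and> c \<sqsubseteq>\<^bsub>T\<^esub> \<Squnion>\<^bsub>T\<^esub> F \<and>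
            finite G \<and> G \<noteq> {} \<and> G \<subseteq> boxes J A T \<phi> \<and> d \<sqsubseteq>\<^bsub>T\<^esub> \<Squnion>\<^bsub>T\<^esub> G \<and>
            (\<forall>e\<in>F. \<forall>g\<in>G. \<not> box_contact J A \<rho> T \<phi> e g))"

text \<open>The two side conditions matter only for \<open>J = {}\<close>: then \<open>\<top>\<close> is the only box, nothing is
  \<open>separated\<close>, and without them \<open>\<bottom>\<close> would be in contact with itself, against \<open>C2\<close>. For
  nonempty \<open>J\<close> they are redundant, see \<open>sum_contact_iff_not_separated\<close> below.\<close>

definition sum_contact ::
  "'j set \<Rightarrow> ('j \<Rightarrow> 'a gorder) \<Rightarrow> ('j \<Rightarrow> 'a \<Rightarrow> 'a \<Rightarrow> bool) \<Rightarrow> 'b gorder \<Rightarrow> ('j \<Rightarrow> 'a \<Rightarrow> 'b) \<Rightarrow>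
    'b \<Rightarrow> 'b \<Rightarrow> bool" where
  "sum_contact J A \<rho> T \<phi> c d \<longleftrightarrow>
     c \<noteq> \<bottom>\<^bsub>T\<^esub> \<and> d \<noteq> \<bottom>\<^bsub>T\<^esub> \<and> \<not> separated J A \<rho> T \<phi> c d"

lemma sum_contact_iff_not_separated:
  assumes J: "J \<noteq> {}"
    and A: "\<And>j. j \<in> J \<Longrightarrow> cnca (A j) (\<rho> j)"
    and T: "complete_boolean_lattice T"
    and \<phi>: "\<And>j. j \<in> J \<Longrightarrow> \<phi> j \<in> ba_hom (A j) T"
    and c: "c \<in> carrier T" and d: "d \<in> carrier T"
  shows "sum_contact J A \<rho> T \<phi> c d \<longleftrightarrow> \<not> separated J A \<rho> T \<phi> c d"
proof -
  interpret T: complete_boolean_lattice T by fact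
  obtain j where j: "j \<in> J" using J by blast
  interpret Aj: cnca "A j" "\<rho> j" using A j by blast
  let ?z = "({j}, \<lambda>_. \<bottom>\<^bsub>A j\<^esub>)" and ?o = "({j}, \<lambda>_. \<top>\<^bsub>A j\<^esub>)"
  have \<phi>j: "\<phi> j \<bottom>\<^bsub>A j\<^esub> = \<bottom>\<^bsub>T\<^esub>" "\<phi> j \<top>\<^bsub>A j\<^esub> = \<top>\<^bsub>T\<^esub>"
    using \<phi>[OF j] by (auto simp: ba_hom_def)
  have sing: "\<Sqinter>\<^bsub>T\<^esub> {x} = x" "\<Squnion>\<^bsub>T\<^esub> {x} = x" if "x \<in> carrier T" for x
    using that T.weak_inf_of_singleton T.weak_sup_of_singleton T.eq_is_equal by auto
  have z: "?z \<in> box_index J A" "box T \<phi> ?z = \<bottom>\<^bsub>T\<^esub>"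
    using j by (auto simp: box_index_def box_def \<phi>j sing)
  have o: "?o \<in> box_index J A" "box T \<phi> ?o = \<top>\<^bsub>T\<^esub>"
    using j by (auto simp: box_index_def box_def \<phi>j sing)
  have nC: "\<not> \<rho> j \<bottom>\<^bsub>A j\<^esub> \<top>\<^bsub>A j\<^esub>" "\<not> \<rho> j \<top>\<^bsub>A j\<^esub> \<bottom>\<^bsub>A j\<^esub>"
    using Aj.C2[OF Aj.bottom_closed Aj.top_closed] Aj.C2[OF Aj.top_closed Aj.bottom_closed]
    by blast+
  have sep1: "\<not> box_contact J A \<rho> T \<phi> \<bottom>\<^bsub>T\<^esub> \<top>\<^bsub>T\<^esub>"
  proof
    assume "box_contact J A \<rho> T \<phi> \<bottom>\<^bsub>T\<^esub> \<top>\<^bsub>T\<^esub>"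
    from this[unfolded box_contact_def, rule_format, OF conjI[OF z(1) conjI[OF o(1) conjI[OF z(2) o(2)]]]]
    show False using nC by simp
  qed
  have sep2: "\<not> box_contact J A \<rho> T \<phi> \<top>\<^bsub>T\<^esub> \<bottom>\<^bsub>T\<^esub>"
  proof
    assume "box_contact J A \<rho> T \<phi> \<top>\<^bsub>T\<^esub> \<bottom>\<^bsub>T\<^esub>"
    from this[unfolded box_contact_def, rule_format, OF conjI[OF o(1) conjI[OF z(1) conjI[OF o(2) z(2)]]]]
    show False using nC by simp
  qed
  have in_boxes: "\<bottom>\<^bsub>T\<^esub> \<in> boxes J A T \<phi>" "\<top>\<^bsub>T\<^esub> \<in> boxes J A T \<phi>"
    using z o unfolding boxes_def by (metis imageI)+
  have "separated J A \<rho> T \<phi> \<bottom>\<^bsub>T\<^esub> d"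
    unfolding separated_def
    by (rule exI[of _ "{\<bottom>\<^bsub>T\<^esub>}"], rule exI[of _ "{\<top>\<^bsub>T\<^esub>}"]) (use sep1 in_boxes d in \<open>simp add: sing\<close>)
  moreover have "separated J A \<rho> T \<phi> c \<bottom>\<^bsub>T\<^esub>"
    unfolding separated_def
    by (rule exI[of _ "{\<top>\<^bsub>T\<^esub>}"], rule exI[of _ "{\<bottom>\<^bsub>T\<^esub>}"]) (use sep2 in_boxes c in \<open>simp add: sing\<close>)
  ultimately show ?thesis
    by (auto simp: sum_contact_def)
qed

end

theory Submission
  imports Defs
begin

text \<open>
  Complete normal contact algebras are the algebras of regular closed sets of compact Hausdorff
  spaces, with \<open>a C b\<close> meaning that \<open>a\<close> and \<open>b\<close> intersect, and morphisms correspond contravariantly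
  to continuous maps. The coproduct is therefore dual to the product of spaces. The proof below is
  point-free: it imitates the construction of a map into a product without using the spaces.

  Two properties of the completed free product \<open>T\<close> carry everything. Nonzero boxes are dense in
  \<open>T\<close> (\<open>boxes_dense\<close>), and the factors are independent (\<open>boxes_independent\<close>). Both come from the
  universal property of the free product with respect to ultrafilters. Moreover, separation of two
  elements of \<open>T\<close>, defined by finite covers by boxes, is the relation \<open>apart\<close> generated by the
  separated pairs of the factors under symmetry, passage to smaller elements and finite joins
  (\<open>not_contact_iff_apart\<close>). Hence statements about separated elements are proved by induction
  over these rules, which reduces them to a single factor.

  That \<open>T\<close> is a complete normal contact algebra is proved in this way or read off from the rules,
  except for the last axiom, where a nonzero box is shrunk coordinatewise (\<open>cnca_contact\<close>). The injections are morphisms because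
  independence and density make them preserve arbitrary joins (\<open>inj_sup_le\<close>).

  For a cocone \<open>f\<close>, the mediating morphism sends \<open>t\<close> to the join of the meets of the \<open>f i (x i)\<close>
  over all boxes below \<open>t\<close> with sides \<open>x i\<close>. It preserves finite meets since boxes are closed under
  them, it respects separation by induction over \<open>apart\<close>, and the fourth axiom holds since a box
  is approximated by approximating its sides. Its composites with the injections are the members
  of the cocone on the nose (\<open>mediating_inj\<close>). For uniqueness, write \<open>h\<^sup>d t = (h (t\<^sup>*))\<^sup>*\<close>, so that
  \<open>h t \<sqsubseteq> h\<^sup>d t\<close>. If \<open>h\<close> and \<open>h'\<close> have the same composites with the injections, then \<open>h\<^sup>d s\<close> and
  \<open>h'\<^sup>d t\<close> are disjoint for separated \<open>s\<close> and \<open>t\<close>, again by induction (\<open>dual_disjoint\<close>). Thus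
  \<open>h s \<sqsubseteq> h' t\<close> if \<open>s\<close> is well inside \<open>t\<close>, that is, separated from the complement of \<open>t\<close>, and
  the fourth axiom for \<open>h\<close> gives \<open>h t \<sqsubseteq> h' t\<close>.
\<close>


section \<open>Boolean algebras and their points\<close>

context boolean_lattice
begin

lemma le_meet_iff:
  "\<lbrakk>x \<in> carrier L; y \<in> carrier L; z \<in> carrier L\<rbrakk> \<Longrightarrow> z \<sqsubseteq> x \<sqinter> y \<longleftrightarrow> z \<sqsubseteq> x \<and> z \<sqsubseteq> y"
  by (meson le_trans meet_closed meet_le meet_left meet_right)

lemma join_le_iff:
  "\<lbrakk>x \<in> carrier L; y \<in> carrier L; z \<in> carrier L\<rbrakk> \<Longrightarrow> x \<squnion> y \<sqsubseteq> z \<longleftrightarrow> x \<sqsubseteq> z \<and> y \<sqsubseteq> z"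
  by (meson le_trans join_closed join_le join_left join_right)

lemma meet_below1: "\<lbrakk>x \<in> carrier L; y \<in> carrier L; z \<in> carrier L; x \<sqsubseteq> z\<rbrakk> \<Longrightarrow> x \<sqinter> y \<sqsubseteq> z"
  and meet_below2: "\<lbrakk>x \<in> carrier L; y \<in> carrier L; z \<in> carrier L; y \<sqsubseteq> z\<rbrakk> \<Longrightarrow> x \<sqinter> y \<sqsubseteq> z"
  using le_trans[of "x \<sqinter> y" x z] le_trans[of "x \<sqinter> y" y z] by (simp_all add: meet_left meet_right)

lemma le_bottom_iff: "x \<in> carrier L \<Longrightarrow> x \<sqsubseteq> \<bottom> \<longleftrightarrow> x = \<bottom>"
  using le_antisym bottom_lower by auto

lemma le_meet_absorb: "\<lbrakk>x \<in> carrier L; y \<in> carrier L; x \<sqsubseteq> y\<rbrakk> \<Longrightarrow> x \<sqinter> y = x"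
  using le_iff_join by auto

lemma meet_bottom: "x \<in> carrier L \<Longrightarrow> x \<sqinter> \<bottom> = \<bottom>"
  by (metis bottom_closed bottom_lower le_meet_absorb meet_comm)

lemma join_bottom: "x \<in> carrier L \<Longrightarrow> x \<squnion> \<bottom> = x"
  by (metis bottom_closed bottom_lower le_iff_meet join_comm)

lemma meet_top: "x \<in> carrier L \<Longrightarrow> x \<sqinter> \<top> = x"
  by (simp add: le_meet_absorb)

lemma le_if_disjoint_join_top:
  assumes "x \<in> carrier L" "y \<in> carrier L" "z \<in> carrier L"
    and "x \<sqinter> y = \<bottom>" "x \<squnion> z = \<top>"
  shows "y \<sqsubseteq> z"
proof -
  have "y = y \<sqinter> (x \<squnion> z)" using assms meet_top by simp
  also have "\<dots> = (y \<sqinter> x) \<squnion> (y \<sqinter> z)" using assms meet_join_distrib by blast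
  also have "\<dots> = y \<sqinter> z" using assms
    by (metis join_bottom join_comm meet_closed meet_comm)
  finally show ?thesis using assms meet_right by metis
qed

lemma compl_eqI:
  assumes "x \<in> carrier L" "y \<in> carrier L" "x \<sqinter> y = \<bottom>" "x \<squnion> y = \<top>"
  shows "compl_in L x = y"
  unfolding compl_in_def
  by (rule the_equality) (use assms le_if_disjoint_join_top le_antisym in blast)+

lemma
  assumes "x \<in> carrier L"
  shows compl_closed: "compl_in L x \<in> carrier L"
    and meet_compl: "x \<sqinter> compl_in L x = \<bottom>"
    and join_compl: "x \<squnion> compl_in L x = \<top>"
  using complement_exists[OF assms] compl_eqI[OF assms] by auto

lemmas closed = meet_closed join_closed compl_closed bottom_closed top_closed

end

definition two_algebra :: "bool gorder" where
  "two_algebra = \<lparr>carrier = UNIV, eq = (=), le = (\<le>)\<rparr>"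

lemma two_least: "least two_algebra x X \<longleftrightarrow> x \<in> X \<and> (\<forall>y\<in>X. x \<le> y)"
  and two_greatest: "greatest two_algebra x X \<longleftrightarrow> x \<in> X \<and> (\<forall>y\<in>X. y \<le> x)"
  by (auto simp: least_def greatest_def two_algebra_def)

lemma two_Upper: "Upper two_algebra X = {u. \<forall>x\<in>X. x \<le> u}"
  and two_Lower: "Lower two_algebra X = {u. \<forall>x\<in>X. u \<le> x}"
  by (auto simp: Upper_def Lower_def two_algebra_def)

lemma two_algebra_simps [simp]:
  "carrier two_algebra = UNIV"
  "\<bottom>\<^bsub>two_algebra\<^esub> = False" "\<top>\<^bsub>two_algebra\<^esub> = True"
  "x \<sqinter>\<^bsub>two_algebra\<^esub> y = (x \<and> y)" "x \<squnion>\<^bsub>two_algebra\<^esub> y = (x \<or> y)"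
  "compl_in two_algebra x = (\<not> x)"
proof -
  show c: "carrier two_algebra = UNIV" by (simp add: two_algebra_def)
  show b: "\<bottom>\<^bsub>two_algebra\<^esub> = False" "\<top>\<^bsub>two_algebra\<^esub> = True"
    unfolding bottom_def top_def two_least two_greatest c by (rule some_equality; auto)+
  show m: "x \<sqinter>\<^bsub>two_algebra\<^esub> y = (x \<and> y)" for x y
    unfolding meet_def inf_def two_greatest two_Lower by (rule some_equality) auto
  show j: "x \<squnion>\<^bsub>two_algebra\<^esub> y = (x \<or> y)" for x y
    unfolding join_def sup_def two_least two_Upper by (rule some_equality) auto
  show "compl_in two_algebra x = (\<not> x)"
    unfolding compl_in_def b c m j by (rule the_equality) auto
qed

lemma boolean_lattice_two: "boolean_lattice two_algebra"
proof -
  have [simp]: "x .=\<^bsub>two_algebra\<^esub> y \<longleftrightarrow> x = y" "x \<sqsubseteq>\<^bsub>two_algebra\<^esub> y \<longleftrightarrow> x \<le> y" for x y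
    by (auto simp: two_algebra_def)
  show ?thesis
  proof unfold_locales
    show "\<exists>s. is_lub two_algebra s {x, y}" for x y
      by (rule exI[of _ "x \<or> y"]) (auto simp: two_least two_Upper)
    show "\<exists>s. is_glb two_algebra s {x, y}" for x y
      by (rule exI[of _ "x \<and> y"]) (auto simp: two_greatest two_Lower)
    show "\<exists>b. least two_algebra b (carrier two_algebra)" 
      by (rule exI[of _ False]) (auto simp: two_least)
    show "\<exists>b. greatest two_algebra b (carrier two_algebra)" 
      by (rule exI[of _ True]) (auto simp: two_greatest)
    show "(.=\<^bsub>two_algebra\<^esub>) = (=)" by (simp add: two_algebra_def)
  qed auto
qed

text \<open>A point is a homomorphism to the two-element algebra, in other words an ultrafilter. The clauses
  are spelled out so that the notion applies to every extension of the order record.\<close>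

definition points :: "('a, 'm) gorder_scheme \<Rightarrow> ('a \<Rightarrow> bool) set" where
  "points L = {u \<in> extensional (carrier L). \<not> u \<bottom>\<^bsub>L\<^esub> \<and> u \<top>\<^bsub>L\<^esub> \<and>
     (\<forall>x\<in>carrier L. \<forall>y\<in>carrier L.
        u (x \<sqinter>\<^bsub>L\<^esub> y) = (u x \<and> u y) \<and> u (x \<squnion>\<^bsub>L\<^esub> y) = (u x \<or> u y)) \<and>
     (\<forall>x\<in>carrier L. u (compl_in L x) = (\<not> u x))}"

lemma points_eq_ba_hom: "points L = ba_hom L two_algebra"
  by (auto simp: points_def ba_hom_def PiE_def)

lemma point_simps:
  assumes "u \<in> points L"
  shows "\<not> u \<bottom>\<^bsub>L\<^esub>" "u \<top>\<^bsub>L\<^esub>"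
    "\<lbrakk>x \<in> carrier L; y \<in> carrier L\<rbrakk> \<Longrightarrow> u (x \<sqinter>\<^bsub>L\<^esub> y) \<longleftrightarrow> u x \<and> u y"
    "\<lbrakk>x \<in> carrier L; y \<in> carrier L\<rbrakk> \<Longrightarrow> u (x \<squnion>\<^bsub>L\<^esub> y) \<longleftrightarrow> u x \<or> u y"
    "x \<in> carrier L \<Longrightarrow> u (compl_in L x) \<longleftrightarrow> \<not> u x"
  using assms by (auto simp: points_def)

context boolean_lattice
begin

definition proper_filter :: "'a set \<Rightarrow> bool" where
  "proper_filter F \<longleftrightarrow> F \<subseteq> carrier L \<and> \<top> \<in> F \<and> \<bottom> \<notin> F \<and>
     (\<forall>x\<in>F. \<forall>y\<in>F. x \<sqinter> y \<in> F) \<and> (\<forall>x\<in>F. \<forall>y\<in>carrier L. x \<sqsubseteq> y \<longrightarrow> y \<in> F)"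

text \<open>If neither \<open>x\<close> nor its complement belonged to \<open>F\<close>, then adding either of them would
  generate the improper filter; the two witnesses of this have a meet in \<open>F\<close> that is disjoint
  from \<open>x\<close> and from its complement, hence is \<open>\<bottom>\<close>.\<close>

lemma maximal_filter_prime:
  assumes F: "proper_filter F" and max: "\<And>G. proper_filter G \<Longrightarrow> F \<subseteq> G \<Longrightarrow> G = F"
    and x: "x \<in> carrier L"
  shows "x \<in> F \<or> compl_in L x \<in> F"
proof -
  note Fs = F[unfolded proper_filter_def]
  have kill: "\<exists>f\<in>F. f \<sqinter> z = \<bottom>" if z: "z \<in> carrier L" "z \<notin> F" for z
  proof (rule ccontr)
    assume no: "\<not> (\<exists>f\<in>F. f \<sqinter> z = \<bottom>)"
    define G where "G = {y \<in> carrier L. \<exists>f\<in>F. f \<sqinter> z \<sqsubseteq> y}"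
    have FG: "F \<subseteq> G" 
    proof
      fix y assume "y \<in> F"
      moreover from this have "y \<in> carrier L" using Fs by blast
      ultimately show "y \<in> G" using meet_left[of y z] z by (auto simp: G_def)
    qed
    have "z \<in> G" using Fs z meet_right[of \<top> z] by (auto simp: G_def)
    moreover have "proper_filter G"
      unfolding proper_filter_def
    proof (intro conjI ballI impI)
      show "G \<subseteq> carrier L" "\<top> \<in> G" using FG Fs by (auto simp: G_def)
      show "\<bottom> \<notin> G" using no Fs z le_bottom_iff by (auto simp: G_def)
      fix p assume "p \<in> G"
      then obtain f where f: "f \<in> F" "f \<sqinter> z \<sqsubseteq> p" "p \<in> carrier L" by (auto simp: G_def)
      then have fL: "f \<in> carrier L" using Fs by blast
      show "q \<in> G" if "q \<in> carrier L" "p \<sqsubseteq> q" for q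
        using f fL that z le_trans[of "f \<sqinter> z" p q] by (auto simp: G_def)
      fix q assume "q \<in> G"
      then obtain g where g: "g \<in> F" "g \<sqinter> z \<sqsubseteq> q" "q \<in> carrier L" by (auto simp: G_def)
      then have gL: "g \<in> carrier L" using Fs by blast
      have "(f \<sqinter> g) \<sqinter> z \<sqsubseteq> f \<sqinter> z" "(f \<sqinter> g) \<sqinter> z \<sqsubseteq> g \<sqinter> z"
        using fL gL z by (simp_all add: le_meet_iff meet_below1 meet_below2)
      then have "(f \<sqinter> g) \<sqinter> z \<sqsubseteq> p \<sqinter> q"
        using f g fL gL z le_trans[of "(f \<sqinter> g) \<sqinter> z" "f \<sqinter> z" p]
          le_trans[of "(f \<sqinter> g) \<sqinter> z" "g \<sqinter> z" q] by (simp add: le_meet_iff)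
      then show "p \<sqinter> q \<in> G" using f g Fs by (auto simp: G_def)
    qed
    ultimately show False using max[OF _ FG] z by blast
  qed
  show ?thesis
  proof (rule ccontr)
    assume "\<not> ?thesis"
    then obtain f g where fg: "f \<in> F" "g \<in> F" "f \<sqinter> x = \<bottom>" "g \<sqinter> compl_in L x = \<bottom>"
      using kill x compl_closed by metis
    then have fgL: "f \<in> carrier L" "g \<in> carrier L" using Fs by auto
    let ?h = "f \<sqinter> g"
    have "?h \<sqinter> x \<sqsubseteq> f \<sqinter> x" "?h \<sqinter> compl_in L x \<sqsubseteq> g \<sqinter> compl_in L x"
      using fgL x by (simp_all add: le_meet_iff meet_below1 meet_below2 closed)
    then have "?h \<sqinter> x = \<bottom>" "?h \<sqinter> compl_in L x = \<bottom>"
      using fg fgL x le_bottom_iff compl_closed by auto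
    then have "?h \<sqinter> (x \<squnion> compl_in L x) = \<bottom>"
      using fgL x by (simp add: meet_join_distrib compl_closed join_bottom)
    then show False using fg fgL x Fs by (metis join_compl meet_closed meet_top)
  qed
qed

text \<open>The Boolean prime ideal theorem, by Zorn's lemma.\<close>

lemma filter_point_exists:
  assumes F0: "proper_filter F0"
  shows "\<exists>u\<in>points L. \<forall>x\<in>F0. u x"
proof -
  let ?X = "{F. proper_filter F \<and> F0 \<subseteq> F}"
  have "\<exists>M\<in>?X. \<forall>F\<in>?X. M \<subseteq> F \<longrightarrow> F = M"
  proof (rule subset_Zorn_nonempty)
    show "?X \<noteq> {}" using F0 by blast
    fix \<C> assume \<C>: "\<C> \<noteq> {}" "subset.chain ?X \<C>"
    have sub: "F \<subseteq> G \<or> G \<subseteq> F" if "F \<in> \<C>" "G \<in> \<C>" for F G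
      using \<C> that unfolding subset.chain_def by blast
    have P: "proper_filter F" "F0 \<subseteq> F" if "F \<in> \<C>" for F
      using \<C> that unfolding subset.chain_def by blast+
    have "x \<sqinter> y \<in> \<Union>\<C>" if xy: "x \<in> \<Union>\<C>" "y \<in> \<Union>\<C>" for x y
    proof -
      obtain F where "F \<in> \<C>" "x \<in> F" "y \<in> F" using xy sub by blast
      then show ?thesis using P unfolding proper_filter_def by blast
    qed
    moreover obtain F where "F \<in> \<C>" using \<C> by blast
    moreover have "y \<in> \<Union>\<C>" if "x \<in> \<Union>\<C>" "y \<in> carrier L" "x \<sqsubseteq> y" for x y
      using that P(1) unfolding proper_filter_def by blast
    moreover have "\<Union>\<C> \<subseteq> carrier L" "\<top> \<in> F" "\<bottom> \<notin> \<Union>\<C>"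
      using P(1) \<open>F \<in> \<C>\<close> unfolding proper_filter_def by blast+
    ultimately have "proper_filter (\<Union>\<C>)"
      using \<open>F \<in> \<C>\<close> unfolding proper_filter_def by blast
    then show "\<Union>\<C> \<in> ?X" using P \<C> by blast
  qed
  then obtain F where F: "proper_filter F" "F0 \<subseteq> F"
    and max: "\<And>G. proper_filter G \<Longrightarrow> F \<subseteq> G \<Longrightarrow> G = F"
    by (smt (verit) mem_Collect_eq subset_trans)
  note Fs = F(1)[unfolded proper_filter_def]
  have up: "y \<in> F" if "x \<in> F" "x \<sqsubseteq> y" "y \<in> carrier L" for x y
    using Fs that by blast
  have compl: "compl_in L x \<in> F \<longleftrightarrow> x \<notin> F" if x: "x \<in> carrier L" for x
    using maximal_filter_prime[OF F(1) max x] Fs x meet_compl by metis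
  have meet: "x \<sqinter> y \<in> F \<longleftrightarrow> x \<in> F \<and> y \<in> F" if "x \<in> carrier L" "y \<in> carrier L" for x y
    using up[of "x \<sqinter> y"] Fs that meet_left[OF that] meet_right[OF that] by blast
  have join: "x \<squnion> y \<in> F \<longleftrightarrow> x \<in> F \<or> y \<in> F" if xy: "x \<in> carrier L" "y \<in> carrier L" for x y
  proof
    show "x \<squnion> y \<in> F" if "x \<in> F \<or> y \<in> F"
      using that up[of _ "x \<squnion> y"] join_left[OF xy] join_right[OF xy] join_closed[OF xy] by blast
    show "x \<in> F \<or> y \<in> F" if "x \<squnion> y \<in> F"
    proof (rule ccontr)
      assume "\<not> ?thesis"
      then have c: "compl_in L x \<sqinter> compl_in L y \<in> F" (is "?c \<in> F")
        using compl xy Fs by simp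
      have "?c \<sqinter> x \<sqsubseteq> x \<sqinter> compl_in L x" "?c \<sqinter> y \<sqsubseteq> y \<sqinter> compl_in L y"
        using xy by (simp_all add: le_meet_iff meet_below1 meet_below2 closed)
      then have "?c \<sqinter> x = \<bottom>" "?c \<sqinter> y = \<bottom>"
        using xy by (simp_all add: meet_compl le_bottom_iff closed)
      then have "?c \<sqinter> (x \<squnion> y) = \<bottom>" using xy by (simp add: meet_join_distrib closed join_bottom)
      then show False using c that Fs by metis
    qed
  qed
  have "(\<lambda>x\<in>carrier L. x \<in> F) \<in> points L"
    using Fs by (simp add: points_def compl meet join closed)
  moreover have "\<forall>x\<in>F0. (\<lambda>x\<in>carrier L. x \<in> F) x" using F Fs by auto
  ultimately show ?thesis by blast
qed

lemma point_exists:
  assumes a: "a \<in> carrier L" "a \<noteq> \<bottom>"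
  shows "\<exists>u\<in>points L. u a"
proof -
  have "proper_filter {y \<in> carrier L. a \<sqsubseteq> y}"
    unfolding proper_filter_def
  proof (intro conjI ballI impI)
    fix x y assume x: "x \<in> {y \<in> carrier L. a \<sqsubseteq> y}"
    show "y \<in> {y \<in> carrier L. a \<sqsubseteq> y}" if "y \<in> carrier L" "x \<sqsubseteq> y"
      using le_trans[of a x y] x a that by simp
    show "x \<sqinter> y \<in> {y \<in> carrier L. a \<sqsubseteq> y}" if "y \<in> {y \<in> carrier L. a \<sqsubseteq> y}"
      using x a that by (simp add: le_meet_iff)
  qed (use a in \<open>auto simp: le_bottom_iff\<close>)
  then obtain u where "u \<in> points L" "\<forall>x\<in>{y \<in> carrier L. a \<sqsubseteq> y}. u x"
    using filter_point_exists by blast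
  then show ?thesis using a by auto
qed

text \<open>Points separate the elements of a Boolean algebra. This reduces finitary Boolean
  (in)equalities, also conditional ones, to propositional logic.\<close>

lemma le_iff_points:
  assumes "x \<in> carrier L" "y \<in> carrier L"
  shows "x \<sqsubseteq> y \<longleftrightarrow> (\<forall>u\<in>points L. u x \<longrightarrow> u y)"
proof
  show "\<forall>u\<in>points L. u x \<longrightarrow> u y" if "x \<sqsubseteq> y"
    using that assms le_meet_absorb[of x y] point_simps(3)[of _ L x y] by auto
  assume *: "\<forall>u\<in>points L. u x \<longrightarrow> u y"
  have "x \<sqinter> compl_in L y = \<bottom>"
  proof (rule ccontr)
    assume "x \<sqinter> compl_in L y \<noteq> \<bottom>"
    then obtain u where "u \<in> points L" "u (x \<sqinter> compl_in L y)"
      using point_exists[of "x \<sqinter> compl_in L y"] assms by (auto simp: closed)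
    then show False using * assms by (auto simp: point_simps closed)
  qed
  moreover have "compl_in L y \<squnion> y = \<top>" using assms by (simp add: join_compl join_comm)
  ultimately show "x \<sqsubseteq> y"
    using le_if_disjoint_join_top[of "compl_in L y" x y] assms by (simp add: meet_comm closed)
qed

lemma eq_iff_points:
  assumes "x \<in> carrier L" "y \<in> carrier L"
  shows "x = y \<longleftrightarrow> (\<forall>u\<in>points L. u x = u y)"
  using le_antisym[OF _ _ assms] le_iff_points assms by auto

lemmas by_points = le_iff_points eq_iff_points point_simps closed

lemma compl_compl: "x \<in> carrier L \<Longrightarrow> compl_in L (compl_in L x) = x"
  by (simp add: by_points)

lemma compl_bottom: "compl_in L \<bottom> = \<top>" and compl_top: "compl_in L \<top> = \<bottom>"
  by (simp_all add: by_points)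

lemma compl_meet: "\<lbrakk>x \<in> carrier L; y \<in> carrier L\<rbrakk> \<Longrightarrow>
    compl_in L (x \<sqinter> y) = compl_in L x \<squnion> compl_in L y"
  and compl_join: "\<lbrakk>x \<in> carrier L; y \<in> carrier L\<rbrakk> \<Longrightarrow>
    compl_in L (x \<squnion> y) = compl_in L x \<sqinter> compl_in L y"
  by (simp_all add: by_points)

lemma compl_mono: "\<lbrakk>x \<in> carrier L; y \<in> carrier L; x \<sqsubseteq> y\<rbrakk> \<Longrightarrow> compl_in L y \<sqsubseteq> compl_in L x"
  by (auto simp: by_points)

lemma le_iff_meet_compl:
  "\<lbrakk>x \<in> carrier L; y \<in> carrier L\<rbrakk> \<Longrightarrow> x \<sqsubseteq> y \<longleftrightarrow> x \<sqinter> compl_in L y = \<bottom>"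
  by (auto simp: by_points)

end

text \<open>Binary meets distribute over arbitrary joins because meeting with \<open>a\<close> has a right adjoint.\<close>

lemma (in complete_boolean_lattice) meet_sup_le:
  assumes "a \<in> carrier L" "X \<subseteq> carrier L" "z \<in> carrier L" "\<And>x. x \<in> X \<Longrightarrow> a \<sqinter> x \<sqsubseteq> z"
  shows "a \<sqinter> \<Squnion>X \<sqsubseteq> z"
proof -
  have "\<Squnion>X \<sqsubseteq> compl_in L a \<squnion> z"
  proof (rule sup_least)
    fix x assume "x \<in> X"
    then have "x \<in> carrier L" "a \<sqinter> x \<sqsubseteq> z" using assms by auto
    then show "x \<sqsubseteq> compl_in L a \<squnion> z" using assms by (auto simp: by_points)
  qed (use assms closed in auto)
  then show ?thesis using assms by (auto simp: by_points)
qed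

lemma cnca_complete_boolean: "cnca B C \<Longrightarrow> complete_boolean_lattice B"
  by (simp add: cnca_def normal_contact_algebra_def contact_algebra_def complete_boolean_lattice_def)

sublocale cnca \<subseteq> complete_boolean_lattice B
  by (rule cnca_complete_boolean) (rule cnca_axioms)


section \<open>Contact algebras and their morphisms\<close>

context cnca
begin

lemma contact_mono:
  assumes "a \<in> carrier B" "b \<in> carrier B" "a' \<in> carrier B" "b' \<in> carrier B"
    and "a' \<sqsubseteq> a" "b' \<sqsubseteq> b" "C a' b'"
  shows "C a b"
proof -
  have "a' \<squnion> a = a" "b' \<squnion> b = b" using assms le_iff_meet by auto
  then have "C a' b" using C4[of a' b' b] assms by auto
  then have "C b a'" using C3 assms by blast
  then have "C b a" using C4[of b a' a] assms \<open>a' \<squnion> a = a\<close> by auto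
  then show ?thesis using C3 assms by blast
qed

lemma contact_sym: "\<lbrakk>a \<in> carrier B; b \<in> carrier B\<rbrakk> \<Longrightarrow> C a b \<longleftrightarrow> C b a"
  using C3 by blast

lemma contact_join_left:
  "\<lbrakk>a \<in> carrier B; b \<in> carrier B; d \<in> carrier B\<rbrakk> \<Longrightarrow> C (a \<squnion> b) d \<longleftrightarrow> C a d \<or> C b d"
  by (simp add: C4 contact_sym[of _ d])

lemma apart_disjoint:
  assumes "a \<in> carrier B" "b \<in> carrier B" "\<not> C a b"
  shows "a \<sqinter> b = \<bottom>"
proof (rule ccontr)
  assume "a \<sqinter> b \<noteq> \<bottom>"
  then have "C (a \<sqinter> b) (a \<sqinter> b)" using C1 assms by simp
  then show False
    using contact_mono[of a b "a \<sqinter> b" "a \<sqinter> b"] assms by (simp add: meet_left meet_right)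
qed

lemma well_inside_le:
  assumes "a \<in> carrier B" "b \<in> carrier B" "\<not> C b (compl_in B a)"
  shows "b \<sqsubseteq> a"
  using apart_disjoint[of b "compl_in B a"] assms by (simp add: le_iff_meet_compl closed)

text \<open>Normality as an interpolation property of the relation ``well inside'': between \<open>a\<close> and the
  complement of \<open>b\<close> there is a third element.\<close>

lemma interpolate:
  assumes "a \<in> carrier B" "b \<in> carrier B" "\<not> C a b"
  shows "\<exists>c\<in>carrier B. \<not> C a (compl_in B c) \<and> \<not> C c b"
proof -
  obtain c where c: "c \<in> carrier B" "\<not> C a c" "\<not> C b (compl_in B c)"
    using C5 assms by blast
  then have "\<not> C (compl_in B c) b" using C3[of "compl_in B c" b] assms by (auto simp: closed)
  then show ?thesis using c by (intro bexI[of _ "compl_in B c"]) (auto simp: compl_compl closed)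
qed

text \<open>If \<open>a\<close> were not below an upper bound \<open>z\<close> of the elements well inside it, then \<open>C6\<close> would put a
  nonzero element well inside the difference \<open>a \<sqinter> z\<^sup>*\<close>; it would lie below \<open>z\<close> and
  below the complement of \<open>z\<close>.\<close>

lemma le_if_well_inside_le:
  assumes "a \<in> carrier B" "z \<in> carrier B"
    and bound: "\<And>b. b \<in> carrier B \<Longrightarrow> \<not> C b (compl_in B a) \<Longrightarrow> b \<sqsubseteq> z"
  shows "a \<sqsubseteq> z"
proof (rule ccontr)
  assume n: "\<not> a \<sqsubseteq> z"
  let ?d = "a \<sqinter> compl_in B z"
  have d: "?d \<in> carrier B" "compl_in B ?d \<in> carrier B" using assms by (auto simp: closed)
  have "compl_in B ?d \<noteq> \<top>"
    using n assms compl_compl[OF d(1)] compl_top by (metis le_iff_meet_compl)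
  then obtain b where b: "b \<in> carrier B" "b \<noteq> \<bottom>" "\<not> C b (compl_in B ?d)"
    using C6 d by blast
  have "compl_in B a \<sqsubseteq> compl_in B ?d" using assms by (auto simp: by_points)
  then have "\<not> C b (compl_in B a)"
    using contact_mono[of b "compl_in B ?d" b "compl_in B a"] b assms d by (auto simp: closed)
  then have "b \<sqsubseteq> z" using bound b by blast
  moreover have "b \<sqsubseteq> ?d" using well_inside_le b d by blast
  ultimately have "b = \<bottom>" using b assms by (auto simp: by_points)
  then show False using b by blast
qed

lemma nonzero_well_inside:
  assumes "a \<in> carrier B" "a \<noteq> \<bottom>"
  shows "\<exists>b\<in>carrier B. b \<noteq> \<bottom> \<and> \<not> C b (compl_in B a)"
  using le_if_well_inside_le[of a \<bottom>] assms by (auto simp: le_bottom_iff)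

end

locale dhc_morphism = A: cnca A C + B: cnca B C'
  for A :: "'a gorder" and C and B :: "'b gorder" and C' +
  fixes f :: "'a \<Rightarrow> 'b"
  assumes hom: "f \<in> dhc_hom A C B C'"
begin

lemma map_closed: "a \<in> carrier A \<Longrightarrow> f a \<in> carrier B"
  and map_bottom: "f \<bottom>\<^bsub>A\<^esub> = \<bottom>\<^bsub>B\<^esub>"
  and map_meet: "\<lbrakk>a \<in> carrier A; b \<in> carrier A\<rbrakk> \<Longrightarrow> f (a \<sqinter>\<^bsub>A\<^esub> b) = f a \<sqinter>\<^bsub>B\<^esub> f b"
  and map_extensional: "f \<in> extensional (carrier A)"
proof -
  have "f \<in> carrier A \<rightarrow>\<^sub>E carrier B" and bot: "f \<bottom>\<^bsub>A\<^esub> = \<bottom>\<^bsub>B\<^esub>"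
    and meet: "\<forall>a\<in>carrier A. \<forall>b\<in>carrier A. f (a \<sqinter>\<^bsub>A\<^esub> b) = f a \<sqinter>\<^bsub>B\<^esub> f b"
    using hom unfolding dhc_hom_def mem_Collect_eq by - (elim conjE, assumption)+
  then show "a \<in> carrier A \<Longrightarrow> f a \<in> carrier B" "f \<in> extensional (carrier A)"
    by (auto simp: PiE_def)
  show "f \<bottom>\<^bsub>A\<^esub> = \<bottom>\<^bsub>B\<^esub>" by (rule bot)
  show "\<lbrakk>a \<in> carrier A; b \<in> carrier A\<rbrakk> \<Longrightarrow> f (a \<sqinter>\<^bsub>A\<^esub> b) = f a \<sqinter>\<^bsub>B\<^esub> f b"
    using meet by blast
qed

lemma map_mono: "\<lbrakk>a \<in> carrier A; b \<in> carrier A; a \<sqsubseteq>\<^bsub>A\<^esub> b\<rbrakk> \<Longrightarrow> f a \<sqsubseteq>\<^bsub>B\<^esub> f b"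
  using map_meet[of a b] A.le_meet_absorb[of a b] B.meet_right[of "f a" "f b"] map_closed by auto

text \<open>The map \<open>a \<mapsto> (f (a\<^sup>*))\<^sup>*\<close> preserves finite joins as \<open>f\<close> preserves finite meets. In
  terms of it the third axiom of a morphism says that separated elements have separated images,
  symmetrically in the two arguments.\<close>

abbreviation dual :: "'a \<Rightarrow> 'b" where
  "dual a \<equiv> compl_in B (f (compl_in A a))"

lemma dual_closed: "a \<in> carrier A \<Longrightarrow> dual a \<in> carrier B"
  by (simp add: map_closed A.closed B.closed)

lemma dual_apart:
  assumes "a \<in> carrier A" "b \<in> carrier A" "\<not> C a b"
  shows "\<not> C' (dual a) (dual b)"
proof -
  have "ll A C a (compl_in A b)" using assms by (simp add: ll_def A.compl_compl)
  then have "ll B C' (dual a) (f (compl_in A b))"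
    using hom assms A.compl_closed unfolding dhc_hom_def by blast
  then show ?thesis by (simp add: ll_def)
qed

text \<open>Since \<open>\<bottom>\<close> is apart from \<open>\<top>\<close>, its dual image is disjoint from the dual image of
  \<open>\<top>\<close>, which is \<open>\<top>\<close>. This is why a morphism preserves \<open>\<top>\<close>.\<close>

lemma dual_bottom: "dual \<bottom>\<^bsub>A\<^esub> = \<bottom>\<^bsub>B\<^esub>"
proof -
  have n: "\<not> C \<bottom>\<^bsub>A\<^esub> \<top>\<^bsub>A\<^esub>" using A.C2[of "\<bottom>\<^bsub>A\<^esub>" "\<top>\<^bsub>A\<^esub>"] by auto
  have "dual \<bottom>\<^bsub>A\<^esub> \<sqinter>\<^bsub>B\<^esub> dual \<top>\<^bsub>A\<^esub> = \<bottom>\<^bsub>B\<^esub>"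
    using B.apart_disjoint[OF dual_closed dual_closed dual_apart[OF _ _ n]] by simp
  then show ?thesis
    using dual_closed[of "\<bottom>\<^bsub>A\<^esub>"]
    by (simp add: A.compl_top A.compl_bottom B.compl_bottom map_bottom B.meet_top)
qed

lemma map_top: "f \<top>\<^bsub>A\<^esub> = \<top>\<^bsub>B\<^esub>"
  using dual_bottom B.compl_compl[of "f \<top>\<^bsub>A\<^esub>"] map_closed[of "\<top>\<^bsub>A\<^esub>"]
  by (simp add: A.compl_bottom B.compl_bottom)

lemma map_compl_disjoint: "a \<in> carrier A \<Longrightarrow> f a \<sqinter>\<^bsub>B\<^esub> f (compl_in A a) = \<bottom>\<^bsub>B\<^esub>"
  using map_meet[of a "compl_in A a"] by (simp add: A.compl_closed A.meet_compl map_bottom)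

lemma map_le_dual: "a \<in> carrier A \<Longrightarrow> f a \<sqsubseteq>\<^bsub>B\<^esub> dual a"
  using map_compl_disjoint[of a]
  by (simp add: B.le_iff_meet_compl B.compl_compl map_closed A.closed B.closed)

lemma dual_mono:
  "\<lbrakk>a \<in> carrier A; b \<in> carrier A; a \<sqsubseteq>\<^bsub>A\<^esub> b\<rbrakk> \<Longrightarrow> dual a \<sqsubseteq>\<^bsub>B\<^esub> dual b"
  by (intro B.compl_mono map_mono A.compl_mono) (auto simp: map_closed A.closed B.closed)

lemma dual_join:
  "\<lbrakk>a \<in> carrier A; b \<in> carrier A\<rbrakk> \<Longrightarrow> dual (a \<squnion>\<^bsub>A\<^esub> b) = dual a \<squnion>\<^bsub>B\<^esub> dual b"
  by (simp add: A.compl_join map_meet B.compl_meet map_closed A.closed)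

text \<open>The map \<open>dual\<close> lies above \<open>f\<close>, but by no more than one step of the relation ``well inside''.\<close>

lemma dual_le_map:
  assumes "a \<in> carrier A" "b \<in> carrier A" "\<not> C a (compl_in A b)"
  shows "dual a \<sqsubseteq>\<^bsub>B\<^esub> f b"
  using B.apart_disjoint[OF _ _ dual_apart[of a "compl_in A b"]] assms
  by (simp add: A.compl_compl B.le_iff_meet_compl map_closed A.closed B.closed)

lemma map_eq_sup: "a \<in> carrier A \<Longrightarrow> f a = \<Squnion>\<^bsub>B\<^esub> (f ` {b \<in> carrier A. ll A C b a})"
  using hom unfolding dhc_hom_def by blast

lemma map_leI:
  assumes "a \<in> carrier A" "z \<in> carrier B"
    and "\<And>b. b \<in> carrier A \<Longrightarrow> \<not> C b (compl_in A a) \<Longrightarrow> f b \<sqsubseteq>\<^bsub>B\<^esub> z"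
  shows "f a \<sqsubseteq>\<^bsub>B\<^esub> z"
  unfolding map_eq_sup[OF assms(1)]
  by (rule B.sup_least) (use assms map_closed in \<open>auto simp: ll_def\<close>)

lemma check_self: "check A C B f = f"
proof
  show "check A C B f a = f a" for a
    using map_extensional map_eq_sup[of a, symmetric]
    by (cases "a \<in> carrier A") (simp_all add: check_def extensional_def)
qed

end

text \<open>The third axiom is asked for in its symmetric form, and the fourth one only as an upper
  estimate of \<open>f a\<close>; the opposite inequality is monotonicity.\<close>

lemma dhc_homI:
  assumes A: "cnca A C" and B: "cnca B C'"
    and f: "f \<in> carrier A \<rightarrow>\<^sub>E carrier B"
    and bot: "f \<bottom>\<^bsub>A\<^esub> = \<bottom>\<^bsub>B\<^esub>"
    and meet: "\<And>a b. \<lbrakk>a \<in> carrier A; b \<in> carrier A\<rbrakk> \<Longrightarrow> f (a \<sqinter>\<^bsub>A\<^esub> b) = f a \<sqinter>\<^bsub>B\<^esub> f b"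
    and apart: "\<And>a b. \<lbrakk>a \<in> carrier A; b \<in> carrier A; \<not> C a b\<rbrakk> \<Longrightarrow>
      \<not> C' (compl_in B (f (compl_in A a))) (compl_in B (f (compl_in A b)))"
    and approx: "\<And>a z. \<lbrakk>a \<in> carrier A; z \<in> carrier B;
      \<And>b. b \<in> carrier A \<Longrightarrow> \<not> C b (compl_in A a) \<Longrightarrow> f b \<sqsubseteq>\<^bsub>B\<^esub> z\<rbrakk> \<Longrightarrow> f a \<sqsubseteq>\<^bsub>B\<^esub> z"
  shows "f \<in> dhc_hom A C B C'"
proof -
  interpret A: cnca A C by fact
  interpret B: cnca B C' by fact
  have fc: "f a \<in> carrier B" if "a \<in> carrier A" for a using f that by auto
  have mono: "f a \<sqsubseteq>\<^bsub>B\<^esub> f b" if "a \<in> carrier A" "b \<in> carrier A" "a \<sqsubseteq>\<^bsub>A\<^esub> b" for a b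
    using meet[of a b] A.le_meet_absorb[of a b] B.meet_right[of "f a" "f b"] fc that by auto
  have "ll B C' (compl_in B (f (compl_in A a))) (f b)"
    if "a \<in> carrier A" "b \<in> carrier A" "ll A C a b" for a b
    using apart[of a "compl_in A b"] that by (simp add: ll_def A.compl_compl A.closed)
  moreover have "f a = \<Squnion>\<^bsub>B\<^esub> (f ` {b \<in> carrier A. ll A C b a})" (is "_ = \<Squnion>\<^bsub>B\<^esub> ?X")
    if a: "a \<in> carrier A" for a
  proof (rule B.le_antisym)
    have X: "?X \<subseteq> carrier B" using fc by auto
    show "\<Squnion>\<^bsub>B\<^esub> ?X \<sqsubseteq>\<^bsub>B\<^esub> f a"
      by (rule B.sup_least) (use X fc a mono A.well_inside_le in \<open>auto simp: ll_def\<close>)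
    show "f a \<sqsubseteq>\<^bsub>B\<^esub> \<Squnion>\<^bsub>B\<^esub> ?X"
      by (rule approx) (use X a in \<open>auto simp: ll_def intro!: B.sup_upper\<close>)
    show "f a \<in> carrier B" "\<Squnion>\<^bsub>B\<^esub> ?X \<in> carrier B" using fc a X by auto
  qed
  ultimately show ?thesis using f bot meet unfolding dhc_hom_def by blast
qed


section \<open>Boxes\<close>

text \<open>The coordinates of a box outside its index set are \<open>\<top>\<close>, so that boxes with
  different index sets can be compared coordinatewise.\<close>

definition coord :: "('j \<Rightarrow> 'a gorder) \<Rightarrow> 'j set \<times> ('j \<Rightarrow> 'a) \<Rightarrow> 'j \<Rightarrow> 'a" where
  "coord A e i = (if i \<in> fst e then snd e i else \<top>\<^bsub>A i\<^esub>)"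

definition box_meet ::
  "('j \<Rightarrow> 'a gorder) \<Rightarrow> 'j set \<times> ('j \<Rightarrow> 'a) \<Rightarrow> 'j set \<times> ('j \<Rightarrow> 'a) \<Rightarrow> 'j set \<times> ('j \<Rightarrow> 'a)"
  where "box_meet A e e' = (fst e \<union> fst e', \<lambda>i. coord A e i \<sqinter>\<^bsub>A i\<^esub> coord A e' i)"

text \<open>Boxes are formed both with the injections into the coproduct and with the members of a
  cocone into a test object; the latter preserve finite meets but need not preserve joins.\<close>

locale box_system = B: complete_boolean_lattice B for B :: "'b gorder" +
  fixes J :: "'j set" and A :: "'j \<Rightarrow> 'a gorder" and f :: "'j \<Rightarrow> 'a \<Rightarrow> 'b"
  assumes factor: "\<And>j. j \<in> J \<Longrightarrow> boolean_lattice (A j)"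
    and map_closed: "\<And>j a. \<lbrakk>j \<in> J; a \<in> carrier (A j)\<rbrakk> \<Longrightarrow> f j a \<in> carrier B"
    and map_top: "\<And>j. j \<in> J \<Longrightarrow> f j \<top>\<^bsub>A j\<^esub> = \<top>\<^bsub>B\<^esub>"
    and map_meet: "\<And>j a b. \<lbrakk>j \<in> J; a \<in> carrier (A j); b \<in> carrier (A j)\<rbrakk> \<Longrightarrow>
      f j (a \<sqinter>\<^bsub>A j\<^esub> b) = f j a \<sqinter>\<^bsub>B\<^esub> f j b"
begin

lemma factor_closed:
  assumes "j \<in> J"
  shows "\<top>\<^bsub>A j\<^esub> \<in> carrier (A j)" "\<bottom>\<^bsub>A j\<^esub> \<in> carrier (A j)"
    "a \<in> carrier (A j) \<Longrightarrow> compl_in (A j) a \<in> carrier (A j)"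
    "\<lbrakk>a \<in> carrier (A j); b \<in> carrier (A j)\<rbrakk> \<Longrightarrow> a \<sqinter>\<^bsub>A j\<^esub> b \<in> carrier (A j)"
proof -
  interpret Aj: boolean_lattice "A j" using factor assms by blast
  show "\<top>\<^bsub>A j\<^esub> \<in> carrier (A j)" "\<bottom>\<^bsub>A j\<^esub> \<in> carrier (A j)"
    "a \<in> carrier (A j) \<Longrightarrow> compl_in (A j) a \<in> carrier (A j)"
    "\<lbrakk>a \<in> carrier (A j); b \<in> carrier (A j)\<rbrakk> \<Longrightarrow> a \<sqinter>\<^bsub>A j\<^esub> b \<in> carrier (A j)"
    by (auto simp: Aj.closed)
qed

lemma map_mono:
  assumes "j \<in> J" "a \<in> carrier (A j)" "b \<in> carrier (A j)" "a \<sqsubseteq>\<^bsub>A j\<^esub> b"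
  shows "f j a \<sqsubseteq>\<^bsub>B\<^esub> f j b"
proof -
  interpret Aj: boolean_lattice "A j" using factor assms by blast
  show ?thesis
    using map_meet[of j a b] Aj.le_meet_absorb[of a b] B.meet_right[of "f j a" "f j b"]
      map_closed assms by auto
qed

lemma coord_closed:
  "\<lbrakk>e \<in> box_index J A; i \<in> J\<rbrakk> \<Longrightarrow> coord A e i \<in> carrier (A i)"
  by (auto simp: box_index_def coord_def factor_closed)

lemma box_image_subset: "e \<in> box_index J A \<Longrightarrow> (\<lambda>i. f i (snd e i)) ` fst e \<subseteq> carrier B"
  by (auto simp: box_index_def map_closed Pi_def subset_iff)

lemma box_closed: "e \<in> box_index J A \<Longrightarrow> box B f e \<in> carrier B"
  using box_image_subset[of e] by (simp add: box_def case_prod_beta)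

lemma le_box_iff_fst:
  assumes "e \<in> box_index J A" "z \<in> carrier B"
  shows "z \<sqsubseteq>\<^bsub>B\<^esub> box B f e \<longleftrightarrow> (\<forall>i\<in>fst e. z \<sqsubseteq>\<^bsub>B\<^esub> f i (snd e i))"
proof
  note sub = box_image_subset[OF assms(1)]
  show "\<forall>i\<in>fst e. z \<sqsubseteq>\<^bsub>B\<^esub> f i (snd e i)" if z: "z \<sqsubseteq>\<^bsub>B\<^esub> box B f e"
  proof
    fix i assume i: "i \<in> fst e"
    then have "box B f e \<sqsubseteq>\<^bsub>B\<^esub> f i (snd e i)"
      using B.inf_lower[OF sub, of "f i (snd e i)"] by (auto simp: box_def case_prod_beta)
    then show "z \<sqsubseteq>\<^bsub>B\<^esub> f i (snd e i)"
      using z i sub B.le_trans[of z "box B f e" "f i (snd e i)"] assms box_closed by auto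
  qed
  show "z \<sqsubseteq>\<^bsub>B\<^esub> box B f e" if "\<forall>i\<in>fst e. z \<sqsubseteq>\<^bsub>B\<^esub> f i (snd e i)"
    unfolding box_def case_prod_beta by (rule B.inf_greatest[OF sub assms(2)]) (use that in auto)
qed

lemma le_box_iff:
  assumes "e \<in> box_index J A" "z \<in> carrier B"
  shows "z \<sqsubseteq>\<^bsub>B\<^esub> box B f e \<longleftrightarrow> (\<forall>i\<in>J. z \<sqsubseteq>\<^bsub>B\<^esub> f i (coord A e i))"
proof -
  have "fst e \<subseteq> J" using assms by (auto simp: box_index_def)
  then show ?thesis
    unfolding le_box_iff_fst[OF assms] using assms by (auto simp: coord_def map_top)
qed

lemma box_le_coord: "\<lbrakk>e \<in> box_index J A; i \<in> J\<rbrakk> \<Longrightarrow> box B f e \<sqsubseteq>\<^bsub>B\<^esub> f i (coord A e i)"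
  using le_box_iff[of e "box B f e"] box_closed by auto

lemma box_meet_index: "\<lbrakk>e \<in> box_index J A; e' \<in> box_index J A\<rbrakk> \<Longrightarrow> box_meet A e e' \<in> box_index J A"
  using coord_closed[of e] coord_closed[of e']
  by (auto simp: box_meet_def box_index_def factor_closed subset_iff)

lemma coord_box_meet:
  assumes "i \<in> J"
  shows "coord A (box_meet A e e') i = coord A e i \<sqinter>\<^bsub>A i\<^esub> coord A e' i"
proof -
  interpret Ai: boolean_lattice "A i" using factor assms by blast
  show ?thesis by (simp add: box_meet_def coord_def Ai.meet_top)
qed

lemma box_box_meet:
  assumes e: "e \<in> box_index J A" "e' \<in> box_index J A"
  shows "box B f (box_meet A e e') = box B f e \<sqinter>\<^bsub>B\<^esub> box B f e'" (is "?l = ?r")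
proof -
  have c: "?l \<in> carrier B" "?r \<in> carrier B" "box B f e \<in> carrier B" "box B f e' \<in> carrier B"
    using box_closed box_meet_index e by auto
  have "z \<sqsubseteq>\<^bsub>B\<^esub> ?l \<longleftrightarrow> z \<sqsubseteq>\<^bsub>B\<^esub> ?r" if "z \<in> carrier B" for z
    using that c e coord_closed
    by (auto simp: B.le_meet_iff le_box_iff box_meet_index coord_box_meet map_meet map_closed)
  from this[OF c(1)] this[OF c(2)] show ?thesis using c B.le_antisym[of ?l ?r] by simp
qed

lemma single_index: "\<lbrakk>i \<in> J; a \<in> carrier (A i)\<rbrakk> \<Longrightarrow> ({i}, \<lambda>_. a) \<in> box_index J A"
  by (auto simp: box_index_def)

lemma box_single: "\<lbrakk>i \<in> J; a \<in> carrier (A i)\<rbrakk> \<Longrightarrow> box B f ({i}, \<lambda>_. a) = f i a"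
  by (simp add: box_def map_closed)

lemma empty_index: "({}, x) \<in> box_index J A"
  by (auto simp: box_index_def)

lemma box_empty: "box B f ({}, x) = \<top>\<^bsub>B\<^esub>"
  using B.weak_inf_empty by (simp add: box_def B.eq_is_equal)

lemma box_insert:
  assumes "(insert i I, x) \<in> box_index J A"
  shows "box B f (insert i I, x) = f i (x i) \<sqinter>\<^bsub>B\<^esub> box B f (I, x)"
    and "(I, x) \<in> box_index J A" and "f i (x i) \<in> carrier B"
proof -
  have c: "f i (x i) \<in> carrier B" "(\<lambda>i. f i (x i)) ` I \<subseteq> carrier B"
    using box_image_subset[OF assms] by auto
  then show "box B f (insert i I, x) = f i (x i) \<sqinter>\<^bsub>B\<^esub> box B f (I, x)" "f i (x i) \<in> carrier B"
    using B.weak_inf_insert[OF c] by (simp_all add: box_def B.eq_is_equal)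
  show "(I, x) \<in> box_index J A" using assms by (auto simp: box_index_def)
qed

end


section \<open>The contact relation of the completed coproduct\<close>

text \<open>The following locale isolates what the argument uses of a completed free product: every
  nonzero element lies above a nonzero box, and a box all of whose coordinates are nonzero is
  nonzero. The second condition also covers the empty index set and trivial factors: if all factors
  are nontrivial, then the box without coordinates, which is \<open>\<top>\<close>, is nonzero.\<close>

locale sum_setting = T: complete_boolean_lattice T
  for T :: "'b gorder" and J :: "'j set" and A :: "'j \<Rightarrow> 'a gorder"
    and \<rho> :: "'j \<Rightarrow> 'a \<Rightarrow> 'a \<Rightarrow> bool" and \<phi> :: "'j \<Rightarrow> 'a \<Rightarrow> 'b" +
  assumes factor_cnca: "\<And>j. j \<in> J \<Longrightarrow> cnca (A j) (\<rho> j)"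
    and inj_hom: "\<And>j. j \<in> J \<Longrightarrow> \<phi> j \<in> ba_hom (A j) T"
    and dense: "\<And>t. \<lbrakk>t \<in> carrier T; t \<noteq> \<bottom>\<^bsub>T\<^esub>\<rbrakk> \<Longrightarrow>
      \<exists>e\<in>box_index J A. box T \<phi> e \<noteq> \<bottom>\<^bsub>T\<^esub> \<and> box T \<phi> e \<sqsubseteq>\<^bsub>T\<^esub> t"
    and independent: "\<And>e. \<lbrakk>e \<in> box_index J A; \<forall>i\<in>J. coord A e i \<noteq> \<bottom>\<^bsub>A i\<^esub>\<rbrakk> \<Longrightarrow>
      box T \<phi> e \<noteq> \<bottom>\<^bsub>T\<^esub>"

sublocale sum_setting \<subseteq> box_system T J A \<phi>
proof (intro box_system.intro box_system_axioms.intro)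
  show "complete_boolean_lattice T" by (rule T.complete_boolean_lattice_axioms)
next
  fix j assume j: "j \<in> J"
  interpret Aj: cnca "A j" "\<rho> j" using factor_cnca j by blast
  show "boolean_lattice (A j)" by (rule Aj.boolean_lattice_axioms)
  show "\<phi> j a \<in> carrier T" if "a \<in> carrier (A j)" for a
    using inj_hom[OF j] that by (auto simp: ba_hom_def)
  show "\<phi> j \<top>\<^bsub>A j\<^esub> = \<top>\<^bsub>T\<^esub>" using inj_hom[OF j] by (simp add: ba_hom_def)
  show "\<phi> j (a \<sqinter>\<^bsub>A j\<^esub> b) = \<phi> j a \<sqinter>\<^bsub>T\<^esub> \<phi> j b" if "a \<in> carrier (A j)" "b \<in> carrier (A j)" for a b
    using inj_hom[OF j] that by (simp add: ba_hom_def)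
qed

context sum_setting
begin

lemma inj_bottom: "j \<in> J \<Longrightarrow> \<phi> j \<bottom>\<^bsub>A j\<^esub> = \<bottom>\<^bsub>T\<^esub>"
  and inj_compl: "\<lbrakk>j \<in> J; a \<in> carrier (A j)\<rbrakk> \<Longrightarrow> \<phi> j (compl_in (A j) a) = compl_in T (\<phi> j a)"
  using inj_hom[of j] by (auto simp: ba_hom_def)

lemma nonzero_box_iff:
  assumes "e \<in> box_index J A"
  shows "box T \<phi> e \<noteq> \<bottom>\<^bsub>T\<^esub> \<longleftrightarrow> (\<forall>i\<in>J. coord A e i \<noteq> \<bottom>\<^bsub>A i\<^esub>)"
  using independent[OF assms] box_le_coord[OF assms] box_closed[OF assms] T.le_bottom_iff
  by (metis inj_bottom)

text \<open>Meeting a box with \<open>\<phi> j d\<close> changes only its \<open>j\<close>-th coordinate.\<close>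

lemma nonzero_box_meet:
  assumes e: "e \<in> box_index J A" "box T \<phi> e \<noteq> \<bottom>\<^bsub>T\<^esub>"
    and j: "j \<in> J" "d \<in> carrier (A j)" "coord A e j \<sqinter>\<^bsub>A j\<^esub> d \<noteq> \<bottom>\<^bsub>A j\<^esub>"
  shows "box T \<phi> e \<sqinter>\<^bsub>T\<^esub> \<phi> j d \<noteq> \<bottom>\<^bsub>T\<^esub>"
proof -
  let ?s = "({j}, \<lambda>_. d)"
  have s: "?s \<in> box_index J A" using j single_index by blast
  have c: "coord A (box_meet A e ?s) i \<noteq> \<bottom>\<^bsub>A i\<^esub>" if i: "i \<in> J" for i
  proof -
    interpret Ai: boolean_lattice "A i" using factor i by blast
    show ?thesis
      using j nonzero_box_iff[OF e(1)] e i coord_closed[OF e(1) i]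
      by (cases "i = j") (simp_all add: coord_box_meet, simp_all add: coord_def Ai.meet_top)
  qed
  have "box T \<phi> (box_meet A e ?s) \<noteq> \<bottom>\<^bsub>T\<^esub>"
    using nonzero_box_iff[OF box_meet_index[OF e(1) s]] c by blast
  then show ?thesis using box_box_meet[OF e(1) s] box_single j by simp
qed

text \<open>Otherwise the \<open>j\<close>-th coordinate meets the complement of \<open>b\<close>, and then so does the box.\<close>

lemma coord_le_if_box_le:
  assumes e: "e \<in> box_index J A" "box T \<phi> e \<noteq> \<bottom>\<^bsub>T\<^esub>"
    and j: "j \<in> J" "b \<in> carrier (A j)" "box T \<phi> e \<sqsubseteq>\<^bsub>T\<^esub> \<phi> j b"
  shows "coord A e j \<sqsubseteq>\<^bsub>A j\<^esub> b"
proof (rule ccontr)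
  interpret Aj: boolean_lattice "A j" using factor j by blast
  assume "\<not> coord A e j \<sqsubseteq>\<^bsub>A j\<^esub> b"
  then have "coord A e j \<sqinter>\<^bsub>A j\<^esub> compl_in (A j) b \<noteq> \<bottom>\<^bsub>A j\<^esub>"
    using j coord_closed[OF e(1)] Aj.le_iff_meet_compl by blast
  then have "box T \<phi> e \<sqinter>\<^bsub>T\<^esub> compl_in T (\<phi> j b) \<noteq> \<bottom>\<^bsub>T\<^esub>"
    using nonzero_box_meet[OF e j(1), of "compl_in (A j) b"] j by (simp add: inj_compl Aj.closed)
  then show False using j T.le_iff_meet_compl box_closed[OF e(1)] map_closed by blast
qed

text \<open>The injections preserve arbitrary joins. A nonzero box below \<open>\<phi> j (\<Squnion> X)\<close> has its
  \<open>j\<close>-th coordinate below \<open>\<Squnion> X\<close>, so this coordinate meets some \<open>x \<in> X\<close>, and by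
  independence the box itself meets \<open>\<phi> j x\<close>. Hence no such box is disjoint from an upper bound
  of the images.\<close>

lemma inj_sup_le:
  assumes j: "j \<in> J" and X: "X \<subseteq> carrier (A j)" and t: "t \<in> carrier T"
    and bound: "\<And>x. x \<in> X \<Longrightarrow> \<phi> j x \<sqsubseteq>\<^bsub>T\<^esub> t"
  shows "\<phi> j (\<Squnion>\<^bsub>A j\<^esub> X) \<sqsubseteq>\<^bsub>T\<^esub> t"
proof (rule ccontr)
  interpret Aj: cnca "A j" "\<rho> j" using factor_cnca j by blast
  let ?s = "\<Squnion>\<^bsub>A j\<^esub> X"
  have s: "?s \<in> carrier (A j)" "\<phi> j ?s \<in> carrier T" using X j map_closed by auto
  assume "\<not> \<phi> j ?s \<sqsubseteq>\<^bsub>T\<^esub> t"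
  then have "\<phi> j ?s \<sqinter>\<^bsub>T\<^esub> compl_in T t \<noteq> \<bottom>\<^bsub>T\<^esub>" using T.le_iff_meet_compl s t by blast
  then obtain e where e: "e \<in> box_index J A" "box T \<phi> e \<noteq> \<bottom>\<^bsub>T\<^esub>"
    and le: "box T \<phi> e \<sqsubseteq>\<^bsub>T\<^esub> \<phi> j ?s \<sqinter>\<^bsub>T\<^esub> compl_in T t"
    using dense[of "\<phi> j ?s \<sqinter>\<^bsub>T\<^esub> compl_in T t"] s t by (auto simp: T.closed)
  have ec: "box T \<phi> e \<in> carrier T" "coord A e j \<in> carrier (A j)"
    using e j box_closed coord_closed by auto
  have les: "box T \<phi> e \<sqsubseteq>\<^bsub>T\<^esub> \<phi> j ?s" "box T \<phi> e \<sqsubseteq>\<^bsub>T\<^esub> compl_in T t"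
    using le s t ec by (auto simp: T.le_meet_iff T.closed)
  have "\<exists>x\<in>X. coord A e j \<sqinter>\<^bsub>A j\<^esub> x \<noteq> \<bottom>\<^bsub>A j\<^esub>"
  proof (rule ccontr)
    assume "\<not> ?thesis"
    then have "coord A e j \<sqinter>\<^bsub>A j\<^esub> ?s \<sqsubseteq>\<^bsub>A j\<^esub> \<bottom>\<^bsub>A j\<^esub>"
      using Aj.meet_sup_le[of "coord A e j" X "\<bottom>\<^bsub>A j\<^esub>"] ec X by auto
    then have "coord A e j = \<bottom>\<^bsub>A j\<^esub>"
      using coord_le_if_box_le[OF e j s(1) les(1)] Aj.le_meet_absorb[of "coord A e j" ?s] ec s
      by (simp add: Aj.le_bottom_iff)
    then show False
      using e j box_le_coord[OF e(1) j] ec by (simp add: inj_bottom T.le_bottom_iff)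
  qed
  then obtain x where x: "x \<in> X" "coord A e j \<sqinter>\<^bsub>A j\<^esub> x \<noteq> \<bottom>\<^bsub>A j\<^esub>" by blast
  then have xc: "x \<in> carrier (A j)" "\<phi> j x \<in> carrier T" using X j map_closed by auto
  have "box T \<phi> e \<sqinter>\<^bsub>T\<^esub> \<phi> j x \<noteq> \<bottom>\<^bsub>T\<^esub>" using nonzero_box_meet[OF e j xc(1) x(2)] .
  moreover have "box T \<phi> e \<sqinter>\<^bsub>T\<^esub> \<phi> j x = \<bottom>\<^bsub>T\<^esub>"
    using bound[OF x(1)] les(2) ec xc t by (auto simp: T.by_points)
  ultimately show False by blast
qed

text \<open>The complement of the contact relation on the coproduct is the least relation that contains the
  images of separated pairs of the factors, relates \<open>\<bottom>\<close> to everything, is symmetric and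
  passes to smaller elements and to finite joins. Finite covers by boxes disappear from this
  description, so that everything about separated elements is proved by induction over the
  rules, with the one nontrivial case in a single factor.\<close>

inductive apart :: "'b \<Rightarrow> 'b \<Rightarrow> bool" where
  apart_base: "\<lbrakk>k \<in> J; p \<in> carrier (A k); q \<in> carrier (A k); \<not> \<rho> k p q\<rbrakk> \<Longrightarrow> apart (\<phi> k p) (\<phi> k q)"
| apart_bottom: "d \<in> carrier T \<Longrightarrow> apart \<bottom>\<^bsub>T\<^esub> d"
| apart_below: "\<lbrakk>apart c d; c' \<in> carrier T; c' \<sqsubseteq>\<^bsub>T\<^esub> c\<rbrakk> \<Longrightarrow> apart c' d"
| apart_join: "\<lbrakk>apart a d; apart b d\<rbrakk> \<Longrightarrow> apart (a \<squnion>\<^bsub>T\<^esub> b) d"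
| apart_sym: "apart a b \<Longrightarrow> apart b a"

lemma apart_closed: "apart c d \<Longrightarrow> c \<in> carrier T \<and> d \<in> carrier T"
  by (induction rule: apart.induct) (auto simp: map_closed)

lemma apart_mono:
  "\<lbrakk>apart c d; c' \<in> carrier T; d' \<in> carrier T; c' \<sqsubseteq>\<^bsub>T\<^esub> c; d' \<sqsubseteq>\<^bsub>T\<^esub> d\<rbrakk> \<Longrightarrow> apart c' d'"
  using apart_below apart_sym by metis

lemma apart_join_right: "\<lbrakk>apart d a; apart d b\<rbrakk> \<Longrightarrow> apart d (a \<squnion>\<^bsub>T\<^esub> b)"
  using apart_join apart_sym by metis

lemma apart_sup:
  assumes "finite F" "\<And>e. e \<in> F \<Longrightarrow> apart e d" "d \<in> carrier T"
  shows "apart (\<Squnion>\<^bsub>T\<^esub> F) d"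
  using assms
proof (induction F)
  case empty
  then show ?case using T.weak_sup_empty apart_bottom by (simp add: T.eq_is_equal)
next
  case (insert e F)
  then have "e \<in> carrier T" "F \<subseteq> carrier T" using apart_closed by blast+
  then have "\<Squnion>\<^bsub>T\<^esub> (insert e F) = e \<squnion>\<^bsub>T\<^esub> \<Squnion>\<^bsub>T\<^esub> F"
    using T.weak_sup_insert by (simp add: T.eq_is_equal)
  then show ?case using insert apart_join by simp
qed

lemma apart_disjoint: "apart c d \<Longrightarrow> c \<sqinter>\<^bsub>T\<^esub> d = \<bottom>\<^bsub>T\<^esub>"
proof (induction rule: apart.induct)
  case (apart_base k p q)
  interpret Ak: cnca "A k" "\<rho> k" using factor_cnca apart_base by blast
  show ?case
    using Ak.apart_disjoint[of p q] apart_base map_meet[of k p q] by (simp add: inj_bottom)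
next
  case (apart_below c d c')
  then have "c \<in> carrier T" "d \<in> carrier T" using apart_closed by blast+
  with apart_below show ?case by (auto simp: T.by_points)
next
  case (apart_join a d b)
  then have "a \<in> carrier T" "b \<in> carrier T" "d \<in> carrier T" using apart_closed by blast+
  with apart_join show ?case by (auto simp: T.by_points)
qed (auto simp: meet_comm T.meet_bottom)

text \<open>Interpolants for \<open>a, d\<close> and for \<open>b, d\<close> combine to one for \<open>a \<squnion> b, d\<close> by taking their
  meet, whose complement is a join of two elements separated from \<open>d\<close>. The symmetry rule
  replaces an interpolant by its complement.\<close>

lemma apart_interpolate:
  "apart c d \<Longrightarrow> \<exists>m\<in>carrier T. apart c m \<and> apart d (compl_in T m)"
proof (induction rule: apart.induct)
  case (apart_base k p q)
  interpret Ak: cnca "A k" "\<rho> k" using factor_cnca apart_base by blast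
  obtain m where m: "m \<in> carrier (A k)" "\<not> \<rho> k p m" "\<not> \<rho> k q (compl_in (A k) m)"
    using Ak.C5 apart_base by blast
  then have "apart (\<phi> k p) (\<phi> k m)" "apart (\<phi> k q) (compl_in T (\<phi> k m))"
    using apart.apart_base[of k p m] apart.apart_base[of k q "compl_in (A k) m"] apart_base
    by (simp_all add: inj_compl Ak.closed)
  then show ?case using map_closed m apart_base by blast
next
  case (apart_bottom d)
  then show ?case
    using apart.apart_bottom[of "\<top>\<^bsub>T\<^esub>"] apart_sym[OF apart.apart_bottom[of d]]
    by (intro bexI[of _ "\<top>\<^bsub>T\<^esub>"]) (auto simp: T.compl_top)
next
  case (apart_below c d c')
  then show ?case using apart.apart_below by blast
next
  case (apart_join a d b)
  then obtain m n where m: "m \<in> carrier T" "apart a m" "apart d (compl_in T m)"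
    and n: "n \<in> carrier T" "apart b n" "apart d (compl_in T n)" by blast
  then have "apart a (m \<sqinter>\<^bsub>T\<^esub> n)" "apart b (m \<sqinter>\<^bsub>T\<^esub> n)"
    using apart_mono[of a m a] apart_mono[of b n b] apart_closed
    by (simp_all add: T.meet_left T.meet_right T.closed)
  then have "apart (a \<squnion>\<^bsub>T\<^esub> b) (m \<sqinter>\<^bsub>T\<^esub> n)" by (rule apart.apart_join)
  moreover have "apart d (compl_in T (m \<sqinter>\<^bsub>T\<^esub> n))"
    using apart_join_right[OF m(3) n(3)] m n by (simp add: T.compl_meet)
  ultimately show ?case using m n T.meet_closed by blast
next
  case (apart_sym a b)
  then obtain m where "m \<in> carrier T" "apart a m" "apart b (compl_in T m)" by blast
  then show ?case by (intro bexI[of _ "compl_in T m"]) (auto simp: T.compl_compl T.closed)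
qed

lemma apart_compl_box:
  assumes "finite I" "(I, x) \<in> box_index J A" "c \<in> carrier T"
    and "\<And>i. i \<in> I \<Longrightarrow> apart c (compl_in T (\<phi> i (x i)))"
  shows "apart c (compl_in T (box T \<phi> (I, x)))"
  using assms
proof (induction I)
  case empty
  then show ?case using apart_sym[OF apart_bottom] by (simp add: box_empty T.compl_top)
next
  case (insert i I)
  note ins = box_insert[OF insert.prems(1)]
  show ?case
    using insert ins box_closed[OF ins(2)] by (simp add: T.compl_meet apart_join_right)
qed

text \<open>The complement of a box is the join of the complements of its sides, and each of these is
  separated from the smaller box through one coordinate.\<close>

lemma box_well_inside:
  assumes x: "(I, x) \<in> box_index J A" and y: "(I, y) \<in> box_index J A"
    and *: "\<And>i. i \<in> I \<Longrightarrow> \<not> \<rho> i (y i) (compl_in (A i) (x i))"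
  shows "apart (box T \<phi> (I, y)) (compl_in T (box T \<phi> (I, x)))"
proof (rule apart_compl_box)
  fix i assume i: "i \<in> I"
  then have iJ: "i \<in> J" and c: "x i \<in> carrier (A i)" "y i \<in> carrier (A i)"
    using x y by (auto simp: box_index_def)
  then have "apart (\<phi> i (y i)) (compl_in T (\<phi> i (x i)))"
    using apart_base[of i "y i" "compl_in (A i) (x i)"] *[OF i] by (simp add: inj_compl factor_closed)
  moreover have "box T \<phi> (I, y) \<sqsubseteq>\<^bsub>T\<^esub> \<phi> i (y i)"
    using box_le_coord[OF y iJ] i by (simp add: coord_def)
  ultimately show "apart (box T \<phi> (I, y)) (compl_in T (\<phi> i (x i)))"
    using apart_below box_closed[OF y] by blast
qed (use x y box_closed in \<open>auto simp: box_index_def\<close>)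

text \<open>Contact of boxes quantifies over all their representations. Given that \<open>e\<close> lies below
  \<open>\<phi> k p\<close>, any representation of \<open>e\<close> can be refined to one with a \<open>k\<close>-th coordinate
  below \<open>p\<close>, so that boxes are out of contact exactly if they lie below separated elements of a
  common factor. In this form the relation visibly passes to smaller boxes.\<close>

lemma not_box_contact_iff:
  assumes "e \<in> boxes J A T \<phi>" "g \<in> boxes J A T \<phi>"
  shows "\<not> box_contact J A \<rho> T \<phi> e g \<longleftrightarrow>
    (\<exists>k\<in>J. \<exists>p\<in>carrier (A k). \<exists>q\<in>carrier (A k).
      e \<sqsubseteq>\<^bsub>T\<^esub> \<phi> k p \<and> g \<sqsubseteq>\<^bsub>T\<^esub> \<phi> k q \<and> \<not> \<rho> k p q)" (is "?l \<longleftrightarrow> ?r")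
proof
  assume ?l
  then obtain I x K y k where x: "(I, x) \<in> box_index J A" "box T \<phi> (I, x) = e"
    and y: "(K, y) \<in> box_index J A" "box T \<phi> (K, y) = g"
    and k: "k \<in> I" "k \<in> K" "\<not> \<rho> k (x k) (y k)"
    unfolding box_contact_def by blast
  then have kJ: "k \<in> J" by (auto simp: box_index_def)
  have "e \<sqsubseteq>\<^bsub>T\<^esub> \<phi> k (x k)" "g \<sqsubseteq>\<^bsub>T\<^esub> \<phi> k (y k)"
    using box_le_coord[OF x(1) kJ] box_le_coord[OF y(1) kJ] x y k by (simp_all add: coord_def)
  moreover have "x k \<in> carrier (A k)" "y k \<in> carrier (A k)"
    using x y k by (auto simp: box_index_def)
  ultimately show ?r using k kJ by blast
next
  assume ?r
  then obtain k p q where k: "k \<in> J" "p \<in> carrier (A k)" "q \<in> carrier (A k)" "\<not> \<rho> k p q"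
    and le: "e \<sqsubseteq>\<^bsub>T\<^esub> \<phi> k p" "g \<sqsubseteq>\<^bsub>T\<^esub> \<phi> k q" by blast
  interpret Ak: cnca "A k" "\<rho> k" using factor_cnca k by blast
  have rep: "\<exists>E. E \<in> box_index J A \<and> box T \<phi> E = h \<and> k \<in> fst E \<and> snd E k \<sqsubseteq>\<^bsub>A k\<^esub> r \<and>
      snd E k \<in> carrier (A k)"
    if h: "h \<in> boxes J A T \<phi>" and r: "r \<in> carrier (A k)" "h \<sqsubseteq>\<^bsub>T\<^esub> \<phi> k r" for h r
  proof -
    obtain H where H: "H \<in> box_index J A" "h = box T \<phi> H" using h by (auto simp: boxes_def)
    let ?s = "({k}, \<lambda>_. r)"
    have s: "?s \<in> box_index J A" using single_index k r by blast
    have "box T \<phi> (box_meet A H ?s) = h"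
      using box_box_meet[OF H(1) s] r H k T.le_meet_absorb[of h "\<phi> k r"] box_closed map_closed
      by (simp add: box_single)
    then show ?thesis
      using box_meet_index[OF H(1) s] coord_closed[OF H(1) k(1)] r
      by (intro exI[of _ "box_meet A H ?s"])
        (auto simp: box_meet_def coord_def[of _ "?s"] Ak.meet_right)
  qed
  obtain E where E: "E \<in> box_index J A" "box T \<phi> E = e" "k \<in> fst E"
    "snd E k \<sqsubseteq>\<^bsub>A k\<^esub> p" "snd E k \<in> carrier (A k)"
    using rep assms(1) k(2) le(1) by blast
  obtain G where G: "G \<in> box_index J A" "box T \<phi> G = g" "k \<in> fst G"
    "snd G k \<sqsubseteq>\<^bsub>A k\<^esub> q" "snd G k \<in> carrier (A k)"
    using rep assms(2) k(3) le(2) by blast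
  have "\<not> \<rho> k (snd E k) (snd G k)"
    using Ak.contact_mono[of p q "snd E k" "snd G k"] k E G by blast
  then show ?l
    using E G unfolding box_contact_def by (metis IntI prod.collapse)
qed

lemma separatedE:
  assumes "separated J A \<rho> T \<phi> c d"
  obtains F G where "finite F" "F \<noteq> {}" "F \<subseteq> boxes J A T \<phi>" "c \<sqsubseteq>\<^bsub>T\<^esub> \<Squnion>\<^bsub>T\<^esub> F"
    "finite G" "G \<noteq> {}" "G \<subseteq> boxes J A T \<phi>" "d \<sqsubseteq>\<^bsub>T\<^esub> \<Squnion>\<^bsub>T\<^esub> G"
    "\<And>e g. e \<in> F \<Longrightarrow> g \<in> G \<Longrightarrow> \<not> box_contact J A \<rho> T \<phi> e g"
  using assms unfolding separated_def by blast

lemma boxes_closed: "boxes J A T \<phi> \<subseteq> carrier T"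
  using box_closed by (auto simp: boxes_def)

lemma separated_apart:
  assumes "c \<in> carrier T" "d \<in> carrier T" "separated J A \<rho> T \<phi> c d"
  shows "apart c d"
proof -
  obtain F G where F: "finite F" "F \<subseteq> boxes J A T \<phi>" "c \<sqsubseteq>\<^bsub>T\<^esub> \<Squnion>\<^bsub>T\<^esub> F"
    and G: "finite G" "G \<subseteq> boxes J A T \<phi>" "d \<sqsubseteq>\<^bsub>T\<^esub> \<Squnion>\<^bsub>T\<^esub> G"
    and FG: "\<And>e g. e \<in> F \<Longrightarrow> g \<in> G \<Longrightarrow> \<not> box_contact J A \<rho> T \<phi> e g"
    using separatedE[OF assms(3)] by metis
  have Gc: "\<Squnion>\<^bsub>T\<^esub> G \<in> carrier T" using G boxes_closed by auto
  have "apart e g" if m: "e \<in> F" "g \<in> G" for e g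
  proof -
    have eg: "e \<in> boxes J A T \<phi>" "g \<in> boxes J A T \<phi>" using F G m by auto
    then obtain k p q where k: "k \<in> J" "p \<in> carrier (A k)" "q \<in> carrier (A k)"
      "e \<sqsubseteq>\<^bsub>T\<^esub> \<phi> k p" "g \<sqsubseteq>\<^bsub>T\<^esub> \<phi> k q" "\<not> \<rho> k p q"
      using not_box_contact_iff FG[OF m] by blast
    show ?thesis
      by (rule apart_mono[OF apart_base[OF k(1,2,3,6)] _ _ k(4,5)]) (use eg boxes_closed in auto)
  qed
  then have "apart g (\<Squnion>\<^bsub>T\<^esub> F)" if "g \<in> G" for g
    by (rule apart_sym[OF apart_sup[OF F(1)]]) (use that G(2) boxes_closed in auto)
  then have "apart (\<Squnion>\<^bsub>T\<^esub> G) (\<Squnion>\<^bsub>T\<^esub> F)"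
    by (rule apart_sup[OF G(1)]) (use F(2) boxes_closed in auto)
  then show ?thesis by (rule apart_mono[OF apart_sym assms(1,2) F(3) G(3)])
qed

lemma separated_sym: 
  assumes "separated J A \<rho> T \<phi> c d"
  shows "separated J A \<rho> T \<phi> d c"
proof -
  obtain F G where F: "finite F" "F \<noteq> {}" "F \<subseteq> boxes J A T \<phi>" "c \<sqsubseteq>\<^bsub>T\<^esub> \<Squnion>\<^bsub>T\<^esub> F"
    and G: "finite G" "G \<noteq> {}" "G \<subseteq> boxes J A T \<phi>" "d \<sqsubseteq>\<^bsub>T\<^esub> \<Squnion>\<^bsub>T\<^esub> G"
    and FG: "\<And>e g. e \<in> F \<Longrightarrow> g \<in> G \<Longrightarrow> \<not> box_contact J A \<rho> T \<phi> e g"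
    using separatedE[OF assms] by metis
  have "\<not> box_contact J A \<rho> T \<phi> g e" if m: "e \<in> F" "g \<in> G" for e g
  proof -
    have eg: "e \<in> boxes J A T \<phi>" "g \<in> boxes J A T \<phi>" using F G m by auto
    then obtain k p q where k: "k \<in> J" "p \<in> carrier (A k)" "q \<in> carrier (A k)"
      "e \<sqsubseteq>\<^bsub>T\<^esub> \<phi> k p" "g \<sqsubseteq>\<^bsub>T\<^esub> \<phi> k q" "\<not> \<rho> k p q"
      using not_box_contact_iff FG[OF m] by blast
    interpret Ak: cnca "A k" "\<rho> k" using factor_cnca k by blast
    have "\<not> \<rho> k q p" using Ak.C3 k by blast
    then show ?thesis using not_box_contact_iff eg k by blast
  qed
  then show ?thesis unfolding separated_def using F G by blast
qed

text \<open>The two given covers of \<open>d\<close> are replaced by their pairwise meets, which are boxes again and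
  still cover \<open>d\<close> by distributivity.\<close>

lemma separated_join:
  assumes c: "a \<in> carrier T" "b \<in> carrier T" "d \<in> carrier T"
    and a: "separated J A \<rho> T \<phi> a d" and b: "separated J A \<rho> T \<phi> b d"
  shows "separated J A \<rho> T \<phi> (a \<squnion>\<^bsub>T\<^esub> b) d"
proof -
  obtain F G where F: "finite F" "F \<noteq> {}" "F \<subseteq> boxes J A T \<phi>" "a \<sqsubseteq>\<^bsub>T\<^esub> \<Squnion>\<^bsub>T\<^esub> F"
    and G: "finite G" "G \<noteq> {}" "G \<subseteq> boxes J A T \<phi>" "d \<sqsubseteq>\<^bsub>T\<^esub> \<Squnion>\<^bsub>T\<^esub> G"
    and FG: "\<And>e g. e \<in> F \<Longrightarrow> g \<in> G \<Longrightarrow> \<not> box_contact J A \<rho> T \<phi> e g"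
    using separatedE[OF a] by metis
  obtain F' G' where F': "finite F'" "F' \<noteq> {}" "F' \<subseteq> boxes J A T \<phi>" "b \<sqsubseteq>\<^bsub>T\<^esub> \<Squnion>\<^bsub>T\<^esub> F'"
    and G': "finite G'" "G' \<noteq> {}" "G' \<subseteq> boxes J A T \<phi>" "d \<sqsubseteq>\<^bsub>T\<^esub> \<Squnion>\<^bsub>T\<^esub> G'"
    and FG': "\<And>e g. e \<in> F' \<Longrightarrow> g \<in> G' \<Longrightarrow> \<not> box_contact J A \<rho> T \<phi> e g"
    using separatedE[OF b] by metis
  define H where "H = (\<lambda>(g, g'). g \<sqinter>\<^bsub>T\<^esub> g') ` (G \<times> G')"
  have Hb: "g \<sqinter>\<^bsub>T\<^esub> g' \<in> boxes J A T \<phi>" if m: "g \<in> G" "g' \<in> G'" for g g'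
  proof -
    obtain E E' where "E \<in> box_index J A" "g = box T \<phi> E" "E' \<in> box_index J A" "g' = box T \<phi> E'"
      using m G(3) G'(3) unfolding boxes_def by blast
    then show ?thesis using box_box_meet box_meet_index unfolding boxes_def by (metis imageI)
  qed
  have H: "finite H" "H \<noteq> {}" "H \<subseteq> boxes J A T \<phi>"
    using G G' Hb by (auto simp: H_def)
  have sub: "F \<subseteq> carrier T" "F' \<subseteq> carrier T" "G \<subseteq> carrier T" "G' \<subseteq> carrier T" "H \<subseteq> carrier T"
    using F F' G G' H boxes_closed by auto
  have "\<Squnion>\<^bsub>T\<^esub> G \<sqinter>\<^bsub>T\<^esub> \<Squnion>\<^bsub>T\<^esub> G' \<sqsubseteq>\<^bsub>T\<^esub> \<Squnion>\<^bsub>T\<^esub> H"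
  proof (rule T.meet_sup_le)
    fix g' assume g': "g' \<in> G'"
    have "g' \<sqinter>\<^bsub>T\<^esub> \<Squnion>\<^bsub>T\<^esub> G \<sqsubseteq>\<^bsub>T\<^esub> \<Squnion>\<^bsub>T\<^esub> H"
    proof (rule T.meet_sup_le)
      fix g assume "g \<in> G"
      then have "g \<sqinter>\<^bsub>T\<^esub> g' \<in> H" using g' by (auto simp: H_def)
      then show "g' \<sqinter>\<^bsub>T\<^esub> g \<sqsubseteq>\<^bsub>T\<^esub> \<Squnion>\<^bsub>T\<^esub> H"
        using T.sup_upper[OF sub(5)] by (simp add: meet_comm)
    qed (use sub g' in auto)
    then show "\<Squnion>\<^bsub>T\<^esub> G \<sqinter>\<^bsub>T\<^esub> g' \<sqsubseteq>\<^bsub>T\<^esub> \<Squnion>\<^bsub>T\<^esub> H" by (simp add: meet_comm)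
  qed (use sub in auto)
  then have dH: "d \<sqsubseteq>\<^bsub>T\<^esub> \<Squnion>\<^bsub>T\<^esub> H"
    using G(4) G'(4) sub c T.le_trans[of d "\<Squnion>\<^bsub>T\<^esub> G \<sqinter>\<^bsub>T\<^esub> \<Squnion>\<^bsub>T\<^esub> G'" "\<Squnion>\<^bsub>T\<^esub> H"]
    by (auto simp: T.le_meet_iff T.closed)
  have up: "\<Squnion>\<^bsub>T\<^esub> F \<sqsubseteq>\<^bsub>T\<^esub> \<Squnion>\<^bsub>T\<^esub> (F \<union> F')" "\<Squnion>\<^bsub>T\<^esub> F' \<sqsubseteq>\<^bsub>T\<^esub> \<Squnion>\<^bsub>T\<^esub> (F \<union> F')"
    by (rule T.sup_least; use sub T.sup_upper[of "F \<union> F'"] in auto)+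
  then have aF: "a \<squnion>\<^bsub>T\<^esub> b \<sqsubseteq>\<^bsub>T\<^esub> \<Squnion>\<^bsub>T\<^esub> (F \<union> F')"
    using F(4) F'(4) sub c T.le_trans[of a "\<Squnion>\<^bsub>T\<^esub> F" "\<Squnion>\<^bsub>T\<^esub> (F \<union> F')"]
      T.le_trans[of b "\<Squnion>\<^bsub>T\<^esub> F'" "\<Squnion>\<^bsub>T\<^esub> (F \<union> F')"]
    by (auto simp: T.join_le_iff)
  have "\<not> box_contact J A \<rho> T \<phi> e (g \<sqinter>\<^bsub>T\<^esub> g')"
    if e: "e \<in> F \<union> F'" and g: "g \<in> G" "g' \<in> G'" for e g g'
  proof -
    have eb: "e \<in> boxes J A T \<phi>" "g \<in> boxes J A T \<phi>" "g' \<in> boxes J A T \<phi>"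
      using e g F F' G G' by auto
    have gc: "g \<in> carrier T" "g' \<in> carrier T" using eb boxes_closed by auto
    obtain h where h: "h \<in> boxes J A T \<phi>" "g \<sqinter>\<^bsub>T\<^esub> g' \<sqsubseteq>\<^bsub>T\<^esub> h" "\<not> box_contact J A \<rho> T \<phi> e h"
      using e FG[OF _ g(1)] FG'[OF _ g(2)] eb T.meet_left[OF gc] T.meet_right[OF gc] by blast
    then obtain k p q where k: "k \<in> J" "p \<in> carrier (A k)" "q \<in> carrier (A k)" "e \<sqsubseteq>\<^bsub>T\<^esub> \<phi> k p"
      "h \<sqsubseteq>\<^bsub>T\<^esub> \<phi> k q" "\<not> \<rho> k p q"
      using not_box_contact_iff[OF eb(1) h(1)] by blast
    moreover have "g \<sqinter>\<^bsub>T\<^esub> g' \<sqsubseteq>\<^bsub>T\<^esub> \<phi> k q"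
      using T.le_trans[OF h(2) k(5)] gc h(1) boxes_closed k map_closed by auto
    ultimately show ?thesis using not_box_contact_iff[OF eb(1) Hb[OF g]] by blast
  qed
  then have "\<forall>e\<in>F \<union> F'. \<forall>h\<in>H. \<not> box_contact J A \<rho> T \<phi> e h" by (auto simp: H_def)
  then show ?thesis
    unfolding separated_def
    by (intro exI[of _ "F \<union> F'"] exI[of _ H] conjI) (use F F' H aF dH in auto)
qed

text \<open>The exceptional cases of \<open>\<bottom>\<close> are genuine: without factors there is no separated pair of
  boxes.\<close>

lemma apart_separated:
  "apart c d \<Longrightarrow> c = \<bottom>\<^bsub>T\<^esub> \<or> d = \<bottom>\<^bsub>T\<^esub> \<or> separated J A \<rho> T \<phi> c d"
proof (induction rule: apart.induct)
  case (apart_base k p q)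
  have b: "\<phi> k p \<in> boxes J A T \<phi>" "\<phi> k q \<in> boxes J A T \<phi>"
    using apart_base box_single single_index unfolding boxes_def by (metis imageI)+
  have c: "\<phi> k p \<in> carrier T" "\<phi> k q \<in> carrier T" using b boxes_closed by auto
  have "\<not> box_contact J A \<rho> T \<phi> (\<phi> k p) (\<phi> k q)"
    using not_box_contact_iff[OF b] apart_base c by (meson T.le_refl)
  then have "separated J A \<rho> T \<phi> (\<phi> k p) (\<phi> k q)"
    unfolding separated_def
    by (intro exI[of _ "{\<phi> k p}"] exI[of _ "{\<phi> k q}"]) (use b c in \<open>auto\<close>)
  then show ?case by blast
next
  case (apart_below c d c')
  have c: "c \<in> carrier T" "d \<in> carrier T" using apart_closed apart_below by blast+
  have "separated J A \<rho> T \<phi> c' d" if s: "separated J A \<rho> T \<phi> c d"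
  proof -
    have "c' \<sqsubseteq>\<^bsub>T\<^esub> \<Squnion>\<^bsub>T\<^esub> F" if "c \<sqsubseteq>\<^bsub>T\<^esub> \<Squnion>\<^bsub>T\<^esub> F" "F \<subseteq> boxes J A T \<phi>" for F
      using T.le_trans[of c' c "\<Squnion>\<^bsub>T\<^esub> F"] that apart_below c boxes_closed by auto
    moreover obtain F G where "finite F" "F \<noteq> {}" "F \<subseteq> boxes J A T \<phi>" "c \<sqsubseteq>\<^bsub>T\<^esub> \<Squnion>\<^bsub>T\<^esub> F"
      "finite G" "G \<noteq> {}" "G \<subseteq> boxes J A T \<phi>" "d \<sqsubseteq>\<^bsub>T\<^esub> \<Squnion>\<^bsub>T\<^esub> G"
      "\<And>e g. e \<in> F \<Longrightarrow> g \<in> G \<Longrightarrow> \<not> box_contact J A \<rho> T \<phi> e g"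
      using separatedE[OF s] by metis
    ultimately show ?thesis
      unfolding separated_def by (intro exI[of _ F] exI[of _ G] conjI ballI) auto
  qed
  then show ?case
    using apart_below.IH apart_below.hyps(2,3) T.le_bottom_iff[of c'] by auto
next
  case (apart_join a d b)
  then have c: "a \<in> carrier T" "b \<in> carrier T" "d \<in> carrier T" using apart_closed by blast+
  then show ?case
    using apart_join.IH separated_join[OF c] T.join_bottom[of a] T.join_bottom[of b] join_comm[of T a b]
    by auto
next
  case (apart_sym a b)
  then show ?case using separated_sym by blast
qed auto

abbreviation contact :: "'b \<Rightarrow> 'b \<Rightarrow> bool" where
  "contact \<equiv> sum_contact J A \<rho> T \<phi>"

lemma not_contact_iff_apart:
  assumes "c \<in> carrier T" "d \<in> carrier T"
  shows "\<not> contact c d \<longleftrightarrow> apart c d"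
  using apart_separated[of c d] separated_apart[OF assms] apart_bottom[OF assms(2)]
    apart_sym[OF apart_bottom[OF assms(1)]]
  unfolding sum_contact_def by auto

text \<open>The last axiom is where boxes are needed. If \<open>a \<noteq> \<top>\<close>, then some nonzero box lies below the
  complement of \<open>a\<close>; shrinking each of its coordinates to a nonzero element well inside gives, by
  independence, a nonzero box that is separated from \<open>a\<close>.\<close>

lemma cnca_contact: "cnca T contact"
proof
  show "contact a a" if "a \<in> carrier T" "a \<noteq> \<bottom>\<^bsub>T\<^esub>" for a
    using apart_disjoint[of a a] T.le_meet_absorb[of a a] that not_contact_iff_apart by auto
  show "a \<noteq> \<bottom>\<^bsub>T\<^esub> \<and> b \<noteq> \<bottom>\<^bsub>T\<^esub>" if "contact a b" for a b
    using that by (auto simp: sum_contact_def)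
  show "contact b a" if "a \<in> carrier T" "b \<in> carrier T" "contact a b" for a b
    using that not_contact_iff_apart[of a b] not_contact_iff_apart[of b a] apart_sym[of b a]
    by auto
  show "contact a (b \<squnion>\<^bsub>T\<^esub> c) \<longleftrightarrow> contact a b \<or> contact a c"
    if abc: "a \<in> carrier T" "b \<in> carrier T" "c \<in> carrier T" for a b c
  proof -
    have "apart a (b \<squnion>\<^bsub>T\<^esub> c) \<longleftrightarrow> apart a b \<and> apart a c"
      using apart_join_right[of a b c] apart_mono[of a "b \<squnion>\<^bsub>T\<^esub> c" a b]
        apart_mono[of a "b \<squnion>\<^bsub>T\<^esub> c" a c] T.join_left[of b c] T.join_right[of b c] abc by auto
    then show ?thesis
      using not_contact_iff_apart[of a b] not_contact_iff_apart[of a c]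
        not_contact_iff_apart[of a "b \<squnion>\<^bsub>T\<^esub> c"] abc by auto
  qed
  show "\<exists>m\<in>carrier T. \<not> contact a m \<and> \<not> contact b (compl_in T m)"
    if "a \<in> carrier T" "b \<in> carrier T" "\<not> contact a b" for a b
    using that apart_interpolate[of a b] not_contact_iff_apart[of a] not_contact_iff_apart[of b]
    by (auto simp: T.closed)
  show "\<exists>b\<in>carrier T. b \<noteq> \<bottom>\<^bsub>T\<^esub> \<and> \<not> contact b a" if a: "a \<in> carrier T" "a \<noteq> \<top>\<^bsub>T\<^esub>" for a
  proof -
    have "compl_in T a \<noteq> \<bottom>\<^bsub>T\<^esub>" using a T.compl_compl[of a] T.compl_bottom by auto
    then obtain I x where x: "(I, x) \<in> box_index J A" "box T \<phi> (I, x) \<noteq> \<bottom>\<^bsub>T\<^esub>"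
      and le: "box T \<phi> (I, x) \<sqsubseteq>\<^bsub>T\<^esub> compl_in T a"
      using dense[of "compl_in T a"] a by (auto simp: T.closed)
    have "\<exists>y. y \<in> carrier (A i) \<and> y \<noteq> \<bottom>\<^bsub>A i\<^esub> \<and> \<not> \<rho> i y (compl_in (A i) (x i))"
      if i: "i \<in> I" for i
    proof -
      have iJ: "i \<in> J" and xi: "x i \<in> carrier (A i)" using i x by (auto simp: box_index_def)
      interpret Ai: cnca "A i" "\<rho> i" using factor_cnca iJ by blast
      have "x i \<noteq> \<bottom>\<^bsub>A i\<^esub>"
        using nonzero_box_iff[OF x(1)] x(2) i iJ by (auto simp: coord_def)
      then show ?thesis using Ai.nonzero_well_inside[of "x i"] xi by blast
    qed
    then obtain y where y: "\<And>i. i \<in> I \<Longrightarrow> y i \<in> carrier (A i)"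
      "\<And>i. i \<in> I \<Longrightarrow> y i \<noteq> \<bottom>\<^bsub>A i\<^esub>"
      "\<And>i. i \<in> I \<Longrightarrow> \<not> \<rho> i (y i) (compl_in (A i) (x i))"
      by metis
    have yb: "(I, y) \<in> box_index J A" using x(1) y(1) by (auto simp: box_index_def)
    have "a \<sqsubseteq>\<^bsub>T\<^esub> compl_in T (box T \<phi> (I, x))"
      using T.compl_mono[OF _ _ le] box_closed[OF x(1)] a by (simp add: T.compl_compl T.closed)
    then have "apart (box T \<phi> (I, y)) a"
      using apart_mono[OF box_well_inside[OF x(1) yb y(3)]] a box_closed[OF yb] by simp
    moreover have "box T \<phi> (I, y) \<noteq> \<bottom>\<^bsub>T\<^esub>"
      using nonzero_box_iff[OF yb] nonzero_box_iff[OF x(1)] x(2) y(2)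
      by (auto simp: coord_def split: if_splits)
    ultimately show ?thesis using not_contact_iff_apart[OF box_closed[OF yb] a(1)] box_closed[OF yb] by blast
  qed
qed

lemma inj_dhc_hom:
  assumes j: "j \<in> J"
  shows "\<phi> j \<in> dhc_hom (A j) (\<rho> j) T contact"
proof (rule dhc_homI)
  interpret Aj: cnca "A j" "\<rho> j" using factor_cnca j by blast
  show "cnca (A j) (\<rho> j)" "cnca T contact" using Aj.cnca_axioms cnca_contact by auto
  show "\<phi> j \<in> carrier (A j) \<rightarrow>\<^sub>E carrier T" using inj_hom[OF j] by (auto simp: ba_hom_def)
  show "\<phi> j \<bottom>\<^bsub>A j\<^esub> = \<bottom>\<^bsub>T\<^esub>" using inj_bottom j by blast
  show "\<phi> j (a \<sqinter>\<^bsub>A j\<^esub> b) = \<phi> j a \<sqinter>\<^bsub>T\<^esub> \<phi> j b"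
    if "a \<in> carrier (A j)" "b \<in> carrier (A j)" for a b
    using map_meet j that by blast
  show "\<not> contact (compl_in T (\<phi> j (compl_in (A j) a))) (compl_in T (\<phi> j (compl_in (A j) b)))"
    if "a \<in> carrier (A j)" "b \<in> carrier (A j)" "\<not> \<rho> j a b" for a b
    using apart_base[OF j that] that j not_contact_iff_apart
    by (simp add: inj_compl T.compl_compl map_closed)
  fix a z assume a: "a \<in> carrier (A j)" and z: "z \<in> carrier T"
    and le: "\<And>b. b \<in> carrier (A j) \<Longrightarrow> \<not> \<rho> j b (compl_in (A j) a) \<Longrightarrow> \<phi> j b \<sqsubseteq>\<^bsub>T\<^esub> z"
  \<comment> \<open>In the factor, \<open>a\<close> is the join of the elements well inside it, and \<open>\<phi> j\<close> preserves joins.\<close>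
  let ?X = "{b \<in> carrier (A j). \<not> \<rho> j b (compl_in (A j) a)}"
  have X: "?X \<subseteq> carrier (A j)" by blast
  have "a \<sqsubseteq>\<^bsub>A j\<^esub> \<Squnion>\<^bsub>A j\<^esub> ?X"
    using Aj.le_if_well_inside_le[of a "\<Squnion>\<^bsub>A j\<^esub> ?X"] a Aj.sup_upper[OF X] X by simp
  then have "\<phi> j a \<sqsubseteq>\<^bsub>T\<^esub> \<phi> j (\<Squnion>\<^bsub>A j\<^esub> ?X)" using map_mono j a X by simp
  moreover have "\<phi> j (\<Squnion>\<^bsub>A j\<^esub> ?X) \<sqsubseteq>\<^bsub>T\<^esub> z" using inj_sup_le[OF j X z] le by blast
  ultimately show "\<phi> j a \<sqsubseteq>\<^bsub>T\<^esub> z"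
    using T.le_trans[of "\<phi> j a" "\<phi> j (\<Squnion>\<^bsub>A j\<^esub> ?X)" z] a z X j map_closed by simp
qed

end


section \<open>The universal property\<close>

locale sum_cocone = sum_setting T J A \<rho> \<phi> + test: cnca B C
  for T :: "'b gorder" and J :: "'j set" and A :: "'j \<Rightarrow> 'a gorder" and \<rho> \<phi>
    and B :: "'t gorder" and C +
  fixes f :: "'j \<Rightarrow> 'a \<Rightarrow> 't"
  assumes cocone: "\<And>j. j \<in> J \<Longrightarrow> f j \<in> dhc_hom (A j) (\<rho> j) B C"
begin

lemma cocone_morphism: "j \<in> J \<Longrightarrow> dhc_morphism (A j) (\<rho> j) B C (f j)"
  by (intro dhc_morphism.intro dhc_morphism_axioms.intro factor_cnca cocone test.cnca_axioms)

lemma cocone_bottom: "j \<in> J \<Longrightarrow> f j \<bottom>\<^bsub>A j\<^esub> = \<bottom>\<^bsub>B\<^esub>"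
  using dhc_morphism.map_bottom[OF cocone_morphism] .

end

sublocale sum_cocone \<subseteq> f: box_system B J A f
proof (intro box_system.intro box_system_axioms.intro)
  show "complete_boolean_lattice B" by (rule test.complete_boolean_lattice_axioms)
next
  fix j assume j: "j \<in> J"
  interpret f: dhc_morphism "A j" "\<rho> j" B C "f j" using cocone_morphism j .
  show "boolean_lattice (A j)" by (rule f.A.boolean_lattice_axioms)
  show "f j a \<in> carrier B" if "a \<in> carrier (A j)" for a using f.map_closed that .
  show "f j \<top>\<^bsub>A j\<^esub> = \<top>\<^bsub>B\<^esub>" by (rule f.map_top)
  show "f j (a \<sqinter>\<^bsub>A j\<^esub> b) = f j a \<sqinter>\<^bsub>B\<^esub> f j b" if "a \<in> carrier (A j)" "b \<in> carrier (A j)" for a b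
    using f.map_meet that .
qed

context sum_cocone
begin

text \<open>For algebras of regular closed sets, a morphism induced by a continuous map \<open>g\<close> sends a set to
  the closure of the preimage of its interior. The interior of \<open>t\<close> is the union of the interiors of
  the boxes in \<open>t\<close>, and the preimage of such an open box under a map into a product is the
  intersection of the preimages of its sides. The definition is this description without points.\<close>

definition mediating :: "'b \<Rightarrow> 't" where
  "mediating = (\<lambda>t\<in>carrier T. \<Squnion>\<^bsub>B\<^esub> (box B f ` {e \<in> box_index J A. box T \<phi> e \<sqsubseteq>\<^bsub>T\<^esub> t}))"

lemma mediating_eq: "t \<in> carrier T \<Longrightarrow>
    mediating t = \<Squnion>\<^bsub>B\<^esub> (box B f ` {e \<in> box_index J A. box T \<phi> e \<sqsubseteq>\<^bsub>T\<^esub> t})"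
  by (simp add: mediating_def)

lemma box_values_closed: "box B f ` {e \<in> box_index J A. box T \<phi> e \<sqsubseteq>\<^bsub>T\<^esub> t} \<subseteq> carrier B"
  using f.box_closed by auto

lemma mediating_closed: "t \<in> carrier T \<Longrightarrow> mediating t \<in> carrier B"
  using box_values_closed by (simp add: mediating_def)

lemma box_le_mediating:
  "\<lbrakk>t \<in> carrier T; e \<in> box_index J A; box T \<phi> e \<sqsubseteq>\<^bsub>T\<^esub> t\<rbrakk> \<Longrightarrow> box B f e \<sqsubseteq>\<^bsub>B\<^esub> mediating t"
  using test.sup_upper[OF box_values_closed[of t], of "box B f e"] by (simp add: mediating_def)

lemma mediating_le:
  assumes "t \<in> carrier T" "z \<in> carrier B"
    and "\<And>e. e \<in> box_index J A \<Longrightarrow> box T \<phi> e \<sqsubseteq>\<^bsub>T\<^esub> t \<Longrightarrow> box B f e \<sqsubseteq>\<^bsub>B\<^esub> z"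
  shows "mediating t \<sqsubseteq>\<^bsub>B\<^esub> z"
proof -
  have "\<Squnion>\<^bsub>B\<^esub> (box B f ` {e \<in> box_index J A. box T \<phi> e \<sqsubseteq>\<^bsub>T\<^esub> t}) \<sqsubseteq>\<^bsub>B\<^esub> z"
    by (rule test.sup_least[OF box_values_closed assms(2)]) (use assms(3) in blast)
  then show ?thesis using assms(1) by (simp add: mediating_def)
qed

lemma mediating_mono:
  assumes "s \<in> carrier T" "t \<in> carrier T" "s \<sqsubseteq>\<^bsub>T\<^esub> t"
  shows "mediating s \<sqsubseteq>\<^bsub>B\<^esub> mediating t"
proof (rule mediating_le)
  fix e assume e: "e \<in> box_index J A" "box T \<phi> e \<sqsubseteq>\<^bsub>T\<^esub> s"
  then have "box T \<phi> e \<sqsubseteq>\<^bsub>T\<^esub> t"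
    using T.le_trans[of "box T \<phi> e" s t] assms box_closed by blast
  then show "box B f e \<sqsubseteq>\<^bsub>B\<^esub> mediating t" using box_le_mediating assms e by blast
qed (use assms mediating_closed in auto)

lemma zero_box_value:
  assumes e: "e \<in> box_index J A" "box T \<phi> e = \<bottom>\<^bsub>T\<^esub>"
  shows "box B f e = \<bottom>\<^bsub>B\<^esub>"
proof -
  obtain i where i: "i \<in> J" "coord A e i = \<bottom>\<^bsub>A i\<^esub>" using nonzero_box_iff e by blast
  then show ?thesis
    using f.box_le_coord[OF e(1) i(1)] f.box_closed[OF e(1)]
    by (simp add: cocone_bottom test.le_bottom_iff)
qed

lemma mediating_bottom: "mediating \<bottom>\<^bsub>T\<^esub> = \<bottom>\<^bsub>B\<^esub>"
proof -
  have "mediating \<bottom>\<^bsub>T\<^esub> \<sqsubseteq>\<^bsub>B\<^esub> \<bottom>\<^bsub>B\<^esub>"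
    by (rule mediating_le) (use zero_box_value T.le_bottom_iff box_closed in auto)
  then show ?thesis using mediating_closed[of "\<bottom>\<^bsub>T\<^esub>"] by (simp add: test.le_bottom_iff)
qed

text \<open>Meets distribute over the two joins of box values, and the meet of a box below \<open>s\<close> with a box
  below \<open>t\<close> is a box below \<open>s \<sqinter> t\<close>.\<close>

lemma mediating_meet:
  assumes st: "s \<in> carrier T" "t \<in> carrier T"
  shows "mediating (s \<sqinter>\<^bsub>T\<^esub> t) = mediating s \<sqinter>\<^bsub>B\<^esub> mediating t"
proof (rule test.le_antisym)
  let ?m = "mediating (s \<sqinter>\<^bsub>T\<^esub> t)"
  have c: "mediating s \<in> carrier B" "mediating t \<in> carrier B" "?m \<in> carrier B"
    using st mediating_closed by auto
  show "?m \<sqsubseteq>\<^bsub>B\<^esub> mediating s \<sqinter>\<^bsub>B\<^esub> mediating t"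
    using mediating_mono[of "s \<sqinter>\<^bsub>T\<^esub> t" s] mediating_mono[of "s \<sqinter>\<^bsub>T\<^esub> t" t] st c
    by (simp add: test.le_meet_iff T.meet_left T.meet_right)
  have prod: "box B f e \<sqinter>\<^bsub>B\<^esub> box B f e' \<sqsubseteq>\<^bsub>B\<^esub> ?m"
    if e: "e \<in> box_index J A" "box T \<phi> e \<sqsubseteq>\<^bsub>T\<^esub> s" and e': "e' \<in> box_index J A" "box T \<phi> e' \<sqsubseteq>\<^bsub>T\<^esub> t"
    for e e'
  proof -
    have "box T \<phi> (box_meet A e e') \<sqsubseteq>\<^bsub>T\<^esub> s \<sqinter>\<^bsub>T\<^esub> t"
      using e e' st box_closed
      by (simp add: box_box_meet T.le_meet_iff T.meet_below1 T.meet_below2)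
    then show ?thesis
      using box_le_mediating[of "s \<sqinter>\<^bsub>T\<^esub> t" "box_meet A e e'"] e e' st
      by (simp add: f.box_box_meet box_meet_index)
  qed
  have "box B f e \<sqinter>\<^bsub>B\<^esub> mediating t \<sqsubseteq>\<^bsub>B\<^esub> ?m" if e: "e \<in> box_index J A" "box T \<phi> e \<sqsubseteq>\<^bsub>T\<^esub> s" for e
    unfolding mediating_eq[OF st(2)]
    by (rule test.meet_sup_le[OF f.box_closed[OF e(1)] box_values_closed c(3)])
      (use prod[OF e] in blast)
  then have swapped: "mediating t \<sqinter>\<^bsub>B\<^esub> box B f e \<sqsubseteq>\<^bsub>B\<^esub> ?m"
    if "e \<in> box_index J A" "box T \<phi> e \<sqsubseteq>\<^bsub>T\<^esub> s" for e
    using that meet_comm[of B "mediating t"] by simp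
  have "mediating t \<sqinter>\<^bsub>B\<^esub> mediating s \<sqsubseteq>\<^bsub>B\<^esub> ?m"
    unfolding mediating_eq[OF st(1)]
    by (rule test.meet_sup_le[OF c(2) box_values_closed c(3)]) (use swapped in blast)
  then show "mediating s \<sqinter>\<^bsub>B\<^esub> mediating t \<sqsubseteq>\<^bsub>B\<^esub> ?m" by (simp add: meet_comm)
qed (use st mediating_closed in auto)

lemma mediating_top: "mediating \<top>\<^bsub>T\<^esub> = \<top>\<^bsub>B\<^esub>"
proof -
  have "\<top>\<^bsub>B\<^esub> \<sqsubseteq>\<^bsub>B\<^esub> mediating \<top>\<^bsub>T\<^esub>"
    using box_le_mediating[of "\<top>\<^bsub>T\<^esub>", OF _ empty_index] by (simp add: box_empty f.box_empty)
  then show ?thesis using mediating_closed[of "\<top>\<^bsub>T\<^esub>"] test.le_antisym[of "mediating \<top>\<^bsub>T\<^esub>"] by simp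
qed

text \<open>The mediating map extends the cocone on the nose: a nonzero box below \<open>\<phi> j a\<close> has its
  \<open>j\<close>-th coordinate below \<open>a\<close>.\<close>

lemma mediating_inj:
  assumes j: "j \<in> J" and a: "a \<in> carrier (A j)"
  shows "mediating (\<phi> j a) = f j a"
proof (rule test.le_antisym)
  have c: "\<phi> j a \<in> carrier T" "f j a \<in> carrier B" using j a map_closed f.map_closed by auto
  then show "mediating (\<phi> j a) \<in> carrier B" "f j a \<in> carrier B" using mediating_closed by auto
  show "mediating (\<phi> j a) \<sqsubseteq>\<^bsub>B\<^esub> f j a"
  proof (rule mediating_le[OF c])
    fix e assume e: "e \<in> box_index J A" "box T \<phi> e \<sqsubseteq>\<^bsub>T\<^esub> \<phi> j a"
    show "box B f e \<sqsubseteq>\<^bsub>B\<^esub> f j a"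
    proof (cases "box T \<phi> e = \<bottom>\<^bsub>T\<^esub>")
      case True
      then show ?thesis using zero_box_value e c by simp
    next
      case False
      then have "coord A e j \<sqsubseteq>\<^bsub>A j\<^esub> a" using coord_le_if_box_le e j a by blast
      then have "f j (coord A e j) \<sqsubseteq>\<^bsub>B\<^esub> f j a" using f.map_mono j a coord_closed e by blast
      then show ?thesis
        using test.le_trans[OF f.box_le_coord[OF e(1) j]] c f.box_closed[OF e(1)]
          f.map_closed[OF j coord_closed[OF e(1) j]] by blast
    qed
  qed
  show "f j a \<sqsubseteq>\<^bsub>B\<^esub> mediating (\<phi> j a)"
    using box_le_mediating[OF c(1) single_index[OF j a]] j a c by (simp add: box_single f.box_single)
qed

text \<open>The generating pairs are handled by the corresponding property of the members of the cocone; the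
  closure rules carry over because \<open>s \<mapsto> (h (s\<^sup>*))\<^sup>*\<close> preserves finite joins if \<open>h\<close> preserves
  finite meets.\<close>

lemma mediating_apart:
  "apart s t \<Longrightarrow>
    \<not> C (compl_in B (mediating (compl_in T s))) (compl_in B (mediating (compl_in T t)))"
proof (induction rule: apart.induct)
  case (apart_base k p q)
  interpret fk: dhc_morphism "A k" "\<rho> k" B C "f k" using cocone_morphism apart_base by blast
  have "mediating (compl_in T (\<phi> k r)) = f k (compl_in (A k) r)" if "r \<in> carrier (A k)" for r
    using mediating_inj[of k "compl_in (A k) r"] apart_base that by (simp add: inj_compl fk.A.closed)
  then show ?case using fk.dual_apart[of p q] apart_base by simp
next
  case (apart_bottom d)
  then have "compl_in B (mediating (compl_in T d)) \<in> carrier B"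
    by (simp add: mediating_closed T.closed test.closed)
  then show ?case
    using test.C2[of "\<bottom>\<^bsub>B\<^esub>"] by (auto simp: T.compl_bottom mediating_top test.compl_top)
next
  case (apart_below c d c')
  then have c: "c \<in> carrier T" "d \<in> carrier T" using apart_closed by blast+
  let ?h = "\<lambda>s. compl_in B (mediating (compl_in T s))"
  have h: "?h c \<in> carrier B" "?h d \<in> carrier B" "?h c' \<in> carrier B"
    using c apart_below by (auto simp: mediating_closed T.closed test.closed)
  have "?h c' \<sqsubseteq>\<^bsub>B\<^esub> ?h c"
    by (intro test.compl_mono mediating_mono T.compl_mono)
      (use c apart_below in \<open>auto simp: mediating_closed T.closed\<close>)
  then show ?case using test.contact_mono[OF h(1,2,3,2)] h apart_below.IH by auto
next
  case (apart_join a d b)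
  then have c: "a \<in> carrier T" "b \<in> carrier T" "d \<in> carrier T" using apart_closed by blast+
  then show ?case
    using apart_join.IH
    by (simp add: T.compl_join mediating_meet test.compl_meet test.contact_join_left
        mediating_closed T.closed test.closed)
next
  case (apart_sym a b)
  then have c: "a \<in> carrier T" "b \<in> carrier T" using apart_closed by blast+
  have "compl_in B (mediating (compl_in T s)) \<in> carrier B" if "s \<in> carrier T" for s
    using that by (simp add: mediating_closed T.closed test.closed)
  then show ?case using test.C3 c apart_sym.IH by blast
qed

text \<open>Each \<open>f i (x i)\<close> is the join of the values of \<open>f i\<close> well inside \<open>x i\<close>. A finite meet of such
  joins is bounded by bounding the meets of the individual values; \<open>v\<close> collects the coordinates
  that have already been replaced.\<close>

lemma box_value_le:
  assumes "finite I" "(I, x) \<in> box_index J A" "v \<in> carrier B" "z \<in> carrier B"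
    and "\<And>y. (I, y) \<in> box_index J A \<Longrightarrow> (\<And>i. i \<in> I \<Longrightarrow> \<not> \<rho> i (y i) (compl_in (A i) (x i))) \<Longrightarrow>
      v \<sqinter>\<^bsub>B\<^esub> box B f (I, y) \<sqsubseteq>\<^bsub>B\<^esub> z"
  shows "v \<sqinter>\<^bsub>B\<^esub> box B f (I, x) \<sqsubseteq>\<^bsub>B\<^esub> z"
  using assms
proof (induction I arbitrary: v)
  case empty
  then show ?case by blast
next
  case (insert i I)
  have iJ: "i \<in> J" and xi: "x i \<in> carrier (A i)" using insert.prems(1) by (auto simp: box_index_def)
  interpret fi: dhc_morphism "A i" "\<rho> i" B C "f i" using cocone_morphism iJ .
  note ins = f.box_insert[OF insert.prems(1)]
  let ?b = "box B f (I, x)"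
  have bc: "?b \<in> carrier B" using f.box_closed ins(2) by blast
  have "f i (x i) \<sqsubseteq>\<^bsub>B\<^esub> compl_in B (v \<sqinter>\<^bsub>B\<^esub> ?b) \<squnion>\<^bsub>B\<^esub> z"
  proof (rule fi.map_leI[OF xi])
    fix b assume b: "b \<in> carrier (A i)" "\<not> \<rho> i b (compl_in (A i) (x i))"
    have fb: "f i b \<in> carrier B" using fi.map_closed b by blast
    have "(v \<sqinter>\<^bsub>B\<^esub> f i b) \<sqinter>\<^bsub>B\<^esub> ?b \<sqsubseteq>\<^bsub>B\<^esub> z"
    proof (rule insert.IH[OF ins(2)])
      fix y assume y: "(I, y) \<in> box_index J A"
        "\<And>i. i \<in> I \<Longrightarrow> \<not> \<rho> i (y i) (compl_in (A i) (x i))"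
      let ?y = "y(i := b)"
      have idx: "(insert i I, ?y) \<in> box_index J A"
        using y(1) b iJ by (auto simp: box_index_def)
      have "\<not> \<rho> k (?y k) (compl_in (A k) (x k))" if "k \<in> insert i I" for k
        using that y(2) b by auto
      then have "v \<sqinter>\<^bsub>B\<^esub> box B f (insert i I, ?y) \<sqsubseteq>\<^bsub>B\<^esub> z" using insert.prems(4)[OF idx] by blast
      moreover have "box B f (I, ?y) = box B f (I, y)"
      proof -
        have "(\<lambda>k. f k (?y k)) ` I = (\<lambda>k. f k (y k)) ` I"
          by (rule image_cong) (use insert.hyps in auto)
        then show ?thesis by (simp add: box_def)
      qed
      ultimately show "(v \<sqinter>\<^bsub>B\<^esub> f i b) \<sqinter>\<^bsub>B\<^esub> box B f (I, y) \<sqsubseteq>\<^bsub>B\<^esub> z"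
        using f.box_insert(1)[OF idx] test.meet_assoc[of v "f i b" "box B f (I, y)"]
          insert.prems(2) fb f.box_closed[OF y(1)] by simp
    qed (use insert.prems fb in auto)
    then show "f i b \<sqsubseteq>\<^bsub>B\<^esub> compl_in B (v \<sqinter>\<^bsub>B\<^esub> ?b) \<squnion>\<^bsub>B\<^esub> z"
      using insert.prems(2,3) fb bc by (auto simp: test.by_points)
  qed (use insert.prems bc in \<open>auto simp: test.closed\<close>)
  then show ?case using insert.prems(2,3) ins bc by (auto simp: test.by_points)
qed

lemma mediating_dhc_hom: "mediating \<in> dhc_hom T contact B C"
proof (rule dhc_homI)
  show "cnca T contact" "cnca B C" using cnca_contact test.cnca_axioms by auto
  show "mediating \<in> carrier T \<rightarrow>\<^sub>E carrier B"
    using mediating_closed by (auto simp: PiE_def extensional_def mediating_def)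
  show "mediating \<bottom>\<^bsub>T\<^esub> = \<bottom>\<^bsub>B\<^esub>" by (rule mediating_bottom)
  show "mediating (a \<sqinter>\<^bsub>T\<^esub> b) = mediating a \<sqinter>\<^bsub>B\<^esub> mediating b" if "a \<in> carrier T" "b \<in> carrier T" for a b
    using mediating_meet that .
  show "\<not> C (compl_in B (mediating (compl_in T a))) (compl_in B (mediating (compl_in T b)))"
    if "a \<in> carrier T" "b \<in> carrier T" "\<not> contact a b" for a b
    using mediating_apart not_contact_iff_apart that by blast
  fix t z assume t: "t \<in> carrier T" and z: "z \<in> carrier B"
    and bound: "\<And>s. s \<in> carrier T \<Longrightarrow> \<not> contact s (compl_in T t) \<Longrightarrow> mediating s \<sqsubseteq>\<^bsub>B\<^esub> z"
  show "mediating t \<sqsubseteq>\<^bsub>B\<^esub> z"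
  proof (rule mediating_le[OF t z])
    fix e assume e: "e \<in> box_index J A" "box T \<phi> e \<sqsubseteq>\<^bsub>T\<^esub> t"
    obtain I x where ex: "e = (I, x)" by (cases e)
    have x: "(I, x) \<in> box_index J A" "finite I" using e ex by (auto simp: box_index_def)
    have "\<top>\<^bsub>B\<^esub> \<sqinter>\<^bsub>B\<^esub> box B f (I, x) \<sqsubseteq>\<^bsub>B\<^esub> z"
    proof (rule box_value_le[OF x(2,1) _ z])
      fix y assume y: "(I, y) \<in> box_index J A"
        "\<And>i. i \<in> I \<Longrightarrow> \<not> \<rho> i (y i) (compl_in (A i) (x i))"
      have yc: "box T \<phi> (I, y) \<in> carrier T" "box B f (I, y) \<in> carrier B"
        using box_closed f.box_closed y(1) by auto
      have "compl_in T t \<sqsubseteq>\<^bsub>T\<^esub> compl_in T (box T \<phi> (I, x))"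
        using T.compl_mono[OF _ t e(2)] box_closed e(1) ex by blast
      then have "apart (box T \<phi> (I, y)) (compl_in T t)"
        by (intro apart_mono[OF box_well_inside[OF x(1) y]]) (use yc t T.compl_closed in auto)
      then have "mediating (box T \<phi> (I, y)) \<sqsubseteq>\<^bsub>B\<^esub> z"
        using bound[OF yc(1)] not_contact_iff_apart[OF yc(1) T.compl_closed[OF t]] by blast
      moreover have "box B f (I, y) \<sqsubseteq>\<^bsub>B\<^esub> mediating (box T \<phi> (I, y))"
        using box_le_mediating[OF yc(1) y(1)] yc by simp
      ultimately show "\<top>\<^bsub>B\<^esub> \<sqinter>\<^bsub>B\<^esub> box B f (I, y) \<sqsubseteq>\<^bsub>B\<^esub> z"
        using yc z mediating_closed[OF yc(1)] by (auto simp: test.by_points)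
    qed simp
    then show "box B f e \<sqsubseteq>\<^bsub>B\<^esub> z"
      using ex f.box_closed[OF x(1)] z by (auto simp: test.by_points)
  qed
qed

lemma mediating_comp:
  assumes j: "j \<in> J"
  shows "dhc_comp (A j) (\<rho> j) B mediating (\<phi> j) = f j"
proof -
  interpret fj: dhc_morphism "A j" "\<rho> j" B C "f j" using cocone_morphism j .
  have "compose (carrier (A j)) mediating (\<phi> j) = f j"
    using fj.map_extensional mediating_inj[OF j]
    by (intro extensionalityI[of _ "carrier (A j)"]) (auto simp: compose_def)
  then show ?thesis by (simp add: dhc_comp_def fj.check_self)
qed

end

text \<open>For the uniqueness of mediating morphisms, let two morphisms have the same composites with all
  injections. The composition of the category only remembers values approximately, so on the image
  of an injection the two maps agree only up to one step of the relation ``well inside''. The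
  fourth axiom makes up for this loss.\<close>

locale sum_parallel_pair = sum_setting T J A \<rho> \<phi> +
  h: dhc_morphism T "sum_contact J A \<rho> T \<phi>" B C h + h': dhc_morphism T "sum_contact J A \<rho> T \<phi>" B C h'
  for T :: "'b gorder" and J :: "'j set" and A :: "'j \<Rightarrow> 'a gorder" and \<rho> \<phi>
    and B :: "'t gorder" and C h h' +
  assumes comp_eq: "\<And>j. j \<in> J \<Longrightarrow> dhc_comp (A j) (\<rho> j) B h (\<phi> j) = dhc_comp (A j) (\<rho> j) B h' (\<phi> j)"
begin

lemma inj_step:
  assumes k: "k \<in> J" and p: "p \<in> carrier (A k)" and q: "q \<in> carrier (A k)"
    and pq: "\<not> \<rho> k p (compl_in (A k) q)"
  shows "h (\<phi> k p) \<sqsubseteq>\<^bsub>B\<^esub> h' (\<phi> k q)"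
proof -
  interpret Ak: cnca "A k" "\<rho> k" using factor_cnca k .
  let ?X = "{b \<in> carrier (A k). ll (A k) (\<rho> k) b q}"
  have c: "g (\<phi> k r) \<in> carrier B" if "r \<in> carrier (A k)" "g = h \<or> g = h'" for g r
    using that map_closed[OF k] h.map_closed h'.map_closed by blast
  have im: "compose (carrier (A k)) g (\<phi> k) ` ?X = (\<lambda>b. g (\<phi> k b)) ` ?X" for g :: "'b \<Rightarrow> 't"
    by (rule image_cong) (auto simp: compose_def)
  have sub: "(\<lambda>b. g (\<phi> k b)) ` ?X \<subseteq> carrier B" if "g = h \<or> g = h'" for g
    using c that by blast
  have "h (\<phi> k p) \<sqsubseteq>\<^bsub>B\<^esub> \<Squnion>\<^bsub>B\<^esub> ((\<lambda>b. h (\<phi> k b)) ` ?X)"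
    by (rule h.B.sup_upper[OF sub]) (use p pq in \<open>auto simp: ll_def\<close>)
  also have "\<dots> = \<Squnion>\<^bsub>B\<^esub> ((\<lambda>b. h' (\<phi> k b)) ` ?X)"
    using fun_cong[OF comp_eq[OF k], of q] q by (simp add: dhc_comp_def check_def im)
  also have "\<dots> \<sqsubseteq>\<^bsub>B\<^esub> h' (\<phi> k q)"
  proof (rule h.B.sup_least[OF sub])
    fix w assume "w \<in> (\<lambda>b. h' (\<phi> k b)) ` ?X"
    then obtain b where b: "b \<in> carrier (A k)" "\<not> \<rho> k b (compl_in (A k) q)" "w = h' (\<phi> k b)"
      by (auto simp: ll_def)
    have "\<phi> k b \<sqsubseteq>\<^bsub>T\<^esub> \<phi> k q" by (rule map_mono[OF k b(1) q Ak.well_inside_le[OF q b(1,2)]])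
    then show "w \<sqsubseteq>\<^bsub>B\<^esub> h' (\<phi> k q)"
      unfolding b(3) by (rule h'.map_mono[OF map_closed[OF k b(1)] map_closed[OF k q]])
  qed (use c q in auto)
  finally show ?thesis using c p q sub by auto
qed

lemma dual_base_disjoint:
  assumes k: "k \<in> J" and p: "p \<in> carrier (A k)" and q: "q \<in> carrier (A k)" and pq: "\<not> \<rho> k p q"
  shows "h.dual (\<phi> k p) \<sqinter>\<^bsub>B\<^esub> h'.dual (\<phi> k q) = \<bottom>\<^bsub>B\<^esub>"
proof -
  interpret Ak: cnca "A k" "\<rho> k" using factor_cnca k .
  \<comment> \<open>One step from \<open>p\<close> to \<open>m\<close> passes from the dual of \<open>h\<close> to \<open>h\<close>, the next one from \<open>h\<close> to \<open>h'\<close>.\<close>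
  obtain m where m: "m \<in> carrier (A k)" "\<not> \<rho> k p (compl_in (A k) m)" "\<not> \<rho> k m q"
    using Ak.interpolate p q pq by blast
  have c: "\<phi> k p \<in> carrier T" "\<phi> k m \<in> carrier T" "\<phi> k (compl_in (A k) q) \<in> carrier T"
    using k p q m map_closed by (auto simp: Ak.closed)
  have "apart (\<phi> k p) (compl_in T (\<phi> k m))"
    using apart_base[OF k p _ m(2)] m k by (simp add: inj_compl Ak.closed)
  then have "\<not> contact (\<phi> k p) (compl_in T (\<phi> k m))"
    using not_contact_iff_apart c T.compl_closed by blast
  then have "h.dual (\<phi> k p) \<sqsubseteq>\<^bsub>B\<^esub> h (\<phi> k m)" using h.dual_le_map c by blast
  moreover have "h (\<phi> k m) \<sqsubseteq>\<^bsub>B\<^esub> h' (\<phi> k (compl_in (A k) q))"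
    using inj_step[OF k m(1), of "compl_in (A k) q"] m q by (simp add: Ak.closed Ak.compl_compl)
  moreover have "h'.dual (\<phi> k q) = compl_in B (h' (\<phi> k (compl_in (A k) q)))"
    using k q by (simp add: inj_compl)
  ultimately show ?thesis
    using h.dual_closed[OF c(1)] h.map_closed[OF c(2)] h'.map_closed[OF c(3)]
    by (simp add: h.B.by_points) blast
qed

lemma swap: "sum_parallel_pair T J A \<rho> \<phi> B C h' h"
  by (intro sum_parallel_pair.intro sum_parallel_pair_axioms.intro sum_setting_axioms
      h.dhc_morphism_axioms h'.dhc_morphism_axioms comp_eq[symmetric])

text \<open>Both orders of the pair appear because separation is symmetric while the claim is not.\<close>

lemma dual_disjoint:
  "apart c d \<Longrightarrow> h.dual c \<sqinter>\<^bsub>B\<^esub> h'.dual d = \<bottom>\<^bsub>B\<^esub> \<and> h'.dual c \<sqinter>\<^bsub>B\<^esub> h.dual d = \<bottom>\<^bsub>B\<^esub>"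
proof (induction rule: apart.induct)
  case (apart_base k p q)
  then show ?case
    using dual_base_disjoint sum_parallel_pair.dual_base_disjoint[OF swap] by blast
next
  case (apart_bottom d)
  then show ?case
    using h.dual_closed[of d] h'.dual_closed[of d]
    unfolding h.dual_bottom h'.dual_bottom by (simp add: h.B.meet_bottom meet_comm[of B "\<bottom>\<^bsub>B\<^esub>"])
next
  case (apart_below c d c')
  then have c: "c \<in> carrier T" "d \<in> carrier T" using apart_closed by blast+
  have mono: "h.dual c' \<sqsubseteq>\<^bsub>B\<^esub> h.dual c" "h'.dual c' \<sqsubseteq>\<^bsub>B\<^esub> h'.dual c"
    using h.dual_mono h'.dual_mono c apart_below by blast+
  have le: "x' \<sqinter>\<^bsub>B\<^esub> y = \<bottom>\<^bsub>B\<^esub>" if "x' \<sqsubseteq>\<^bsub>B\<^esub> x" "x \<sqinter>\<^bsub>B\<^esub> y = \<bottom>\<^bsub>B\<^esub>" "x \<in> carrier B" "x' \<in> carrier B" "y \<in> carrier B"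
    for x x' y using that by (auto simp: h.B.by_points)
  show ?case
    using le[OF mono(1), of "h'.dual d"] le[OF mono(2), of "h.dual d"] apart_below.IH
      h.dual_closed[of c] h.dual_closed[of c'] h.dual_closed[of d]
      h'.dual_closed[of c] h'.dual_closed[of c'] h'.dual_closed[of d] c apart_below.hyps(2)
    by auto
next
  case (apart_join a d b)
  then have c: "a \<in> carrier T" "b \<in> carrier T" "d \<in> carrier T" using apart_closed by blast+
  have join: "(x \<squnion>\<^bsub>B\<^esub> y) \<sqinter>\<^bsub>B\<^esub> z = \<bottom>\<^bsub>B\<^esub>"
    if "x \<sqinter>\<^bsub>B\<^esub> z = \<bottom>\<^bsub>B\<^esub>" "y \<sqinter>\<^bsub>B\<^esub> z = \<bottom>\<^bsub>B\<^esub>" "x \<in> carrier B" "y \<in> carrier B" "z \<in> carrier B" for x y z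
    using that by (auto simp: h.B.by_points)
  show ?case
    unfolding h.dual_join[OF c(1,2)] h'.dual_join[OF c(1,2)]
    using apart_join.IH c h.dual_closed h'.dual_closed by (intro conjI join) auto
next
  case (apart_sym a b)
  then show ?case by (simp add: meet_comm)
qed

lemma le_pointwise:
  assumes t: "t \<in> carrier T"
  shows "h t \<sqsubseteq>\<^bsub>B\<^esub> h' t"
proof (rule h.map_leI[OF t])
  show "h' t \<in> carrier B" using h'.map_closed t .
  fix s assume s: "s \<in> carrier T" "\<not> contact s (compl_in T t)"
  then have "h.dual s \<sqinter>\<^bsub>B\<^esub> h'.dual (compl_in T t) = \<bottom>\<^bsub>B\<^esub>"
    using dual_disjoint not_contact_iff_apart t T.compl_closed by blast
  then have "h.dual s \<sqsubseteq>\<^bsub>B\<^esub> h' t"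
    using h.B.le_iff_meet_compl[of "h.dual s" "h' t"] h.dual_closed s t h'.map_closed
    by (simp add: T.compl_compl)
  then show "h s \<sqsubseteq>\<^bsub>B\<^esub> h' t"
    using h.B.le_trans[OF h.map_le_dual[OF s(1)]] h.map_closed h.dual_closed h'.map_closed s t
    by blast
qed

lemma eq: "h = h'"
proof (rule extensionalityI)
  show "h \<in> extensional (carrier T)" "h' \<in> extensional (carrier T)"
    using h.map_extensional h'.map_extensional .
  show "h t = h' t" if "t \<in> carrier T" for t
    using h.B.le_antisym[OF le_pointwise sum_parallel_pair.le_pointwise[OF swap]] that
      h.map_closed h'.map_closed by blast
qed

end

lemma (in sum_setting) dhc_sum_contact: "dhc_sum TYPE('t) J A \<rho> T contact \<phi>"
  unfolding dhc_sum_def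
proof (intro conjI ballI allI impI)
  show "cnca T contact" by (rule cnca_contact)
  show "\<phi> j \<in> dhc_hom (A j) (\<rho> j) T contact" if "j \<in> J" for j using inj_dhc_hom that .
  fix B :: "'t gorder" and C f
  assume B: "cnca B C" and f: "\<forall>j\<in>J. f j \<in> dhc_hom (A j) (\<rho> j) B C"
  interpret sum_cocone T J A \<rho> \<phi> B C f
    using f by (intro sum_cocone.intro sum_cocone_axioms.intro sum_setting_axioms B) auto
  show "\<exists>!h. h \<in> dhc_hom T contact B C \<and> (\<forall>j\<in>J. dhc_comp (A j) (\<rho> j) B h (\<phi> j) = f j)"
  proof (rule ex1I)
    show "mediating \<in> dhc_hom T contact B C \<and>
        (\<forall>j\<in>J. dhc_comp (A j) (\<rho> j) B mediating (\<phi> j) = f j)"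
      using mediating_dhc_hom mediating_comp by blast
    fix h assume h: "h \<in> dhc_hom T contact B C \<and> (\<forall>j\<in>J. dhc_comp (A j) (\<rho> j) B h (\<phi> j) = f j)"
    have "dhc_morphism T contact B C g" if "g \<in> dhc_hom T contact B C" for g
      by (intro dhc_morphism.intro dhc_morphism_axioms.intro that B cnca_contact)
    then have "sum_parallel_pair T J A \<rho> \<phi> B C h mediating"
      by (intro sum_parallel_pair.intro sum_parallel_pair_axioms.intro sum_setting_axioms)
        (use h mediating_dhc_hom mediating_comp in auto)
    then show "h = mediating" by (rule sum_parallel_pair.eq)
  qed
qed


section \<open>Completed free products\<close>

lemma ba_hom_compose:
  assumes A: "boolean_lattice A" and h: "h \<in> ba_hom A B" and g: "g \<in> ba_hom B D"
  shows "compose (carrier A) g h \<in> ba_hom A D"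
proof -
  interpret A: boolean_lattice A by fact
  show ?thesis
    using h g by (simp add: ba_hom_def compose_def A.closed Pi_iff PiE_iff extensional_def)
qed

text \<open>At the two-element algebra the universal property of the free product says that a point of
  \<open>S\<close> is the same as a family of points of the factors. Existence of the point for a given family
  yields independence of the factors, and its uniqueness yields that the boxes are dense.\<close>

locale completed_free_product =
  fixes J :: "'j set" and A :: "'j \<Rightarrow> 'a gorder" and \<rho> :: "'j \<Rightarrow> 'a \<Rightarrow> 'a \<Rightarrow> bool"
    and S T :: "'b gorder" and \<phi> :: "'j \<Rightarrow> 'a \<Rightarrow> 'b"
  assumes factor_cnca: "\<And>j. j \<in> J \<Longrightarrow> cnca (A j) (\<rho> j)"
    and sum: "ba_sum TYPE(bool) J A S \<phi>"
    and completion: "ba_completion S T"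
begin

lemma S_boolean: "boolean_lattice S"
  and T_complete: "complete_boolean_lattice T"
  and sum_hom: "j \<in> J \<Longrightarrow> \<phi> j \<in> ba_hom (A j) S"
  and inclusion_hom: "(\<lambda>x\<in>carrier S. x) \<in> ba_hom S T"
  and factor_boolean: "j \<in> J \<Longrightarrow> boolean_lattice (A j)"
  using sum completion factor_cnca
  by (auto simp: ba_sum_def ba_completion_def cnca_def normal_contact_algebra_def contact_algebra_def)

lemma S_subset: "x \<in> carrier S \<Longrightarrow> x \<in> carrier T"
  using completion by (auto simp: ba_completion_def)

end

sublocale completed_free_product \<subseteq> S: boolean_lattice S
  by (rule S_boolean)

sublocale completed_free_product \<subseteq> T: complete_boolean_lattice T
  by (rule T_complete)

context completed_free_product
begin

lemma S_ops: "\<top>\<^bsub>S\<^esub> = \<top>\<^bsub>T\<^esub>" "\<bottom>\<^bsub>S\<^esub> = \<bottom>\<^bsub>T\<^esub>"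
  "\<lbrakk>x \<in> carrier S; y \<in> carrier S\<rbrakk> \<Longrightarrow> x \<sqinter>\<^bsub>S\<^esub> y = x \<sqinter>\<^bsub>T\<^esub> y"
  using inclusion_hom by (auto simp: ba_hom_def S.closed)

lemma inj_hom:
  assumes j: "j \<in> J"
  shows "\<phi> j \<in> ba_hom (A j) T"
proof -
  have "compose (carrier (A j)) (\<lambda>x\<in>carrier S. x) (\<phi> j) = \<phi> j"
    using sum_hom[OF j] by (auto simp: compose_def fun_eq_iff ba_hom_def PiE_iff extensional_def)
  then show ?thesis
    using ba_hom_compose[OF factor_boolean[OF j] sum_hom[OF j] inclusion_hom] by simp
qed

lemma box_system: "box_system T J A \<phi>"
proof (intro box_system.intro box_system_axioms.intro T_complete factor_boolean)
  fix j assume "j \<in> J"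
  note h = inj_hom[OF this]
  show "\<phi> j a \<in> carrier T" if "a \<in> carrier (A j)" for a using h that by (auto simp: ba_hom_def)
  show "\<phi> j \<top>\<^bsub>A j\<^esub> = \<top>\<^bsub>T\<^esub>" using h by (simp add: ba_hom_def)
  show "\<phi> j (a \<sqinter>\<^bsub>A j\<^esub> b) = \<phi> j a \<sqinter>\<^bsub>T\<^esub> \<phi> j b" if "a \<in> carrier (A j)" "b \<in> carrier (A j)" for a b
    using h that by (simp add: ba_hom_def)
qed

end

sublocale completed_free_product \<subseteq> box_system T J A \<phi>
  by (rule box_system)

context completed_free_product
begin

lemma coproduct_point:
  assumes "\<And>j. j \<in> J \<Longrightarrow> f j \<in> points (A j)"
  shows "\<exists>!h. h \<in> points S \<and> (\<forall>j\<in>J. compose (carrier (A j)) h (\<phi> j) = f j)"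
  using sum assms boolean_lattice_two unfolding ba_sum_def points_eq_ba_hom by blast

lemma points_eq_on_S:
  assumes u: "u \<in> points T" and v: "v \<in> points T"
    and eq: "\<And>j a. j \<in> J \<Longrightarrow> a \<in> carrier (A j) \<Longrightarrow> u (\<phi> j a) = v (\<phi> j a)"
    and s: "s \<in> carrier S"
  shows "u s = v s"
proof -
  let ?r = "\<lambda>w. compose (carrier S) w (\<lambda>x\<in>carrier S. x)"
  have r: "?r w \<in> points S" if "w \<in> points T" for w
    using ba_hom_compose[OF S_boolean inclusion_hom] that by (simp add: points_eq_ba_hom)
  have f: "compose (carrier (A j)) (?r u) (\<phi> j) \<in> points (A j)" if "j \<in> J" for j
    using ba_hom_compose[OF factor_boolean[OF that] sum_hom[OF that]] r[OF u]
    by (simp add: points_eq_ba_hom)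
  have "compose (carrier (A j)) (?r v) (\<phi> j) = compose (carrier (A j)) (?r u) (\<phi> j)" if "j \<in> J" for j
    using eq[OF that] sum_hom[OF that] by (auto simp: compose_def fun_eq_iff ba_hom_def PiE_iff)
  then have "?r u = ?r v" using coproduct_point[OF f] r[OF u] r[OF v] by (metis (no_types, lifting))
  from fun_cong[OF this, of s] s show ?thesis by (simp add: compose_def)
qed

lemma box_in_S:
  assumes "finite I" "(I, x) \<in> box_index J A" "u \<in> points S" "\<And>i. i \<in> I \<Longrightarrow> u (\<phi> i (x i))"
  shows "box T \<phi> (I, x) \<in> carrier S \<and> u (box T \<phi> (I, x))"
  using assms
proof (induction I)
  case empty
  then show ?case using S.top_closed point_simps(2)[of u S] by (simp add: box_empty S_ops)
next
  case (insert i I)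
  note ins = box_insert[OF insert.prems(1)]
  have "i \<in> J" "x i \<in> carrier (A i)" using insert.prems(1) by (auto simp: box_index_def)
  then have i: "\<phi> i (x i) \<in> carrier S" using sum_hom[of i] by (auto simp: ba_hom_def)
  have IH: "box T \<phi> (I, x) \<in> carrier S" "u (box T \<phi> (I, x))"
    using insert.IH[OF ins(2)] insert.prems by auto
  show ?case
    using S_ops(3)[OF i IH(1)] S.meet_closed[OF i IH(1)] point_simps(3)[OF insert.prems(2) i IH(1)]
      ins(1) IH(2) insert.prems(3) by simp
qed

text \<open>Choose points of the factors that contain the given coordinates; the corresponding point of
  \<open>S\<close> contains the box.\<close>

lemma boxes_independent:
  assumes e: "e \<in> box_index J A" and nz: "\<forall>i\<in>J. coord A e i \<noteq> \<bottom>\<^bsub>A i\<^esub>"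
  shows "box T \<phi> e \<noteq> \<bottom>\<^bsub>T\<^esub>"
proof -
  have "\<exists>u. u \<in> points (A i) \<and> u (coord A e i)" if i: "i \<in> J" for i
    using boolean_lattice.point_exists[OF factor_boolean[OF i] coord_closed[OF e i]] nz i by blast
  then obtain g where g: "\<And>i. i \<in> J \<Longrightarrow> g i \<in> points (A i)" "\<And>i. i \<in> J \<Longrightarrow> g i (coord A e i)"
    by metis
  obtain h where h: "h \<in> points S" "\<And>j. j \<in> J \<Longrightarrow> compose (carrier (A j)) h (\<phi> j) = g j"
    using coproduct_point[OF g(1)] by blast
  obtain I x where ex: "e = (I, x)" by (cases e)
  have I: "finite I" "I \<subseteq> J" using e ex by (auto simp: box_index_def)
  have "h (\<phi> i (x i))" if i: "i \<in> I" for i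
  proof -
    have iJ: "i \<in> J" and c: "coord A e i = x i" using i I ex by (auto simp: coord_def)
    have "g i (x i) = h (\<phi> i (x i))"
      using fun_cong[OF h(2)[OF iJ], of "x i"] coord_closed[OF e iJ] c by (simp add: compose_def)
    then show ?thesis using g(2)[OF iJ] c by simp
  qed
  then have "h (box T \<phi> e)" using box_in_S[OF I(1)] e ex h(1) by blast
  then show ?thesis using point_simps(1)[OF h(1)] by (auto simp: S_ops)
qed

text \<open>A compactness argument. Let \<open>u\<close> be a point that contains \<open>s\<close>. If no box in \<open>u\<close> were below
  \<open>s\<close>, then these boxes and the complement of \<open>s\<close> would generate a proper filter, and a point \<open>v\<close>
  containing it would agree with \<open>u\<close> on the images of all factors, though not on \<open>s\<close>.\<close>

lemma boxes_dense:
  assumes t: "t \<in> carrier T" "t \<noteq> \<bottom>\<^bsub>T\<^esub>"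
  shows "\<exists>e\<in>box_index J A. box T \<phi> e \<noteq> \<bottom>\<^bsub>T\<^esub> \<and> box T \<phi> e \<sqsubseteq>\<^bsub>T\<^esub> t"
proof -
  obtain s where s: "s \<in> carrier S" "s \<noteq> \<bottom>\<^bsub>T\<^esub>" "s \<sqsubseteq>\<^bsub>T\<^esub> t"
    using completion t unfolding ba_completion_def by blast
  have sT: "s \<in> carrier T" using s S_subset by blast
  obtain u where u: "u \<in> points T" "u s" using T.point_exists[OF sT s(2)] by blast
  have "\<exists>e\<in>box_index J A. u (box T \<phi> e) \<and> box T \<phi> e \<sqsubseteq>\<^bsub>T\<^esub> s"
  proof (rule ccontr)
    assume no: "\<not> ?thesis"
    let ?c = "compl_in T s"
    let ?F = "{y \<in> carrier T. \<exists>e\<in>box_index J A. u (box T \<phi> e) \<and> box T \<phi> e \<sqinter>\<^bsub>T\<^esub> ?c \<sqsubseteq>\<^bsub>T\<^esub> y}"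
    have cT: "?c \<in> carrier T" using sT T.compl_closed by blast
    have FI: "y \<in> ?F" if "y \<in> carrier T" "e \<in> box_index J A" "u (box T \<phi> e)"
      "box T \<phi> e \<sqinter>\<^bsub>T\<^esub> ?c \<sqsubseteq>\<^bsub>T\<^esub> y" for y e
      using that by blast
    have top: "({}, x) \<in> box_index J A \<and> u (box T \<phi> ({}, x))" for x
      using empty_index[of x] box_empty[of x] point_simps(2)[OF u(1)] by simp
    have "T.proper_filter ?F"
      unfolding T.proper_filter_def
    proof (intro conjI ballI impI)
      show "\<top>\<^bsub>T\<^esub> \<in> ?F"
        by (rule FI[of _ "({}, undefined)"]) (use top cT in \<open>auto simp: box_empty\<close>)
      show "\<bottom>\<^bsub>T\<^esub> \<notin> ?F"
      proof
        assume "\<bottom>\<^bsub>T\<^esub> \<in> ?F"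
        then obtain e where e: "e \<in> box_index J A" "u (box T \<phi> e)" "box T \<phi> e \<sqinter>\<^bsub>T\<^esub> ?c \<sqsubseteq>\<^bsub>T\<^esub> \<bottom>\<^bsub>T\<^esub>"
          by blast
        then have "box T \<phi> e \<sqsubseteq>\<^bsub>T\<^esub> s"
          using T.le_iff_meet_compl[OF box_closed[OF e(1)] sT] box_closed[OF e(1)] cT
          by (simp add: T.le_bottom_iff)
        then show False using no e by blast
      qed
      fix y assume "y \<in> ?F"
      then obtain e where y: "y \<in> carrier T" "e \<in> box_index J A" "u (box T \<phi> e)"
        "box T \<phi> e \<sqinter>\<^bsub>T\<^esub> ?c \<sqsubseteq>\<^bsub>T\<^esub> y" by blast
      have ec: "box T \<phi> e \<in> carrier T" using box_closed y by blast
      show "z \<in> ?F" if "z \<in> carrier T" "y \<sqsubseteq>\<^bsub>T\<^esub> z" for z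
        using T.le_trans[OF y(4) that(2)] FI[OF that(1) y(2,3)] ec cT y that by simp
      fix z assume "z \<in> ?F"
      then obtain e' where z: "z \<in> carrier T" "e' \<in> box_index J A" "u (box T \<phi> e')"
        "box T \<phi> e' \<sqinter>\<^bsub>T\<^esub> ?c \<sqsubseteq>\<^bsub>T\<^esub> z" by blast
      have ec': "box T \<phi> e' \<in> carrier T" using box_closed z by blast
      show "y \<sqinter>\<^bsub>T\<^esub> z \<in> ?F"
      proof (rule FI[of _ "box_meet A e e'"])
        show "u (box T \<phi> (box_meet A e e'))"
          using y z ec ec' u(1) by (simp add: box_box_meet point_simps)
        show "box T \<phi> (box_meet A e e') \<sqinter>\<^bsub>T\<^esub> ?c \<sqsubseteq>\<^bsub>T\<^esub> y \<sqinter>\<^bsub>T\<^esub> z"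
          using y z ec ec' cT by (auto simp: box_box_meet T.by_points)
      qed (use y z box_meet_index in auto)
    qed blast
    then obtain v where v: "v \<in> points T" "\<And>y. y \<in> ?F \<Longrightarrow> v y"
      using T.filter_point_exists[of ?F] by blast
    have "v ?c"
      by (rule v(2), rule FI[of _ "({}, undefined)"])
        (use top cT in \<open>auto simp: box_empty T.meet_right\<close>)
    have imp: "v (\<phi> j a)" if j: "j \<in> J" "a \<in> carrier (A j)" "u (\<phi> j a)" for j a
      by (rule v(2), rule FI[of _ "({j}, \<lambda>_. a)"])
        (use j cT in \<open>auto simp: box_single single_index map_closed T.meet_left\<close>)
    have "u (\<phi> j a) = v (\<phi> j a)" if j: "j \<in> J" "a \<in> carrier (A j)" for j a
    proof -
      have "\<phi> j (compl_in (A j) a) = compl_in T (\<phi> j a)"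
        using inj_hom[OF j(1)] j(2) by (simp add: ba_hom_def)
      then show ?thesis
        using imp[OF j] imp[OF j(1) factor_closed(3)[OF j(1) j(2)]] u(1) v(1) map_closed[OF j]
        by (auto simp: point_simps)
    qed
    then have "v s" using points_eq_on_S[OF u(1) v(1) _ s(1)] u(2) by blast
    then show False using \<open>v ?c\<close> v(1) sT by (simp add: point_simps)
  qed
  then obtain e where e: "e \<in> box_index J A" "u (box T \<phi> e)" "box T \<phi> e \<sqsubseteq>\<^bsub>T\<^esub> s" by blast
  then have "box T \<phi> e \<sqsubseteq>\<^bsub>T\<^esub> t" using T.le_trans[OF e(3) s(3)] box_closed sT t by blast
  moreover have "box T \<phi> e \<noteq> \<bottom>\<^bsub>T\<^esub>" using e(2) point_simps(1)[OF u(1)] by auto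
  ultimately show ?thesis using e(1) by blast
qed

lemma sum_setting: "sum_setting T J A \<rho> \<phi>"
  by (intro sum_setting.intro sum_setting_axioms.intro T_complete factor_cnca inj_hom
      boxes_dense boxes_independent)

end

theorem theorem3p7:
  fixes J :: "'j set"
    and A :: "'j \<Rightarrow> 'a gorder" and \<rho> :: "'j \<Rightarrow> 'a \<Rightarrow> 'a \<Rightarrow> bool"
    and S T :: "'b gorder" and \<phi> :: "'j \<Rightarrow> 'a \<Rightarrow> 'b"
  assumes "\<And>j. j \<in> J \<Longrightarrow> cnca (A j) (\<rho> j)"
    and "ba_sum TYPE('b) J A S \<phi>" and "ba_sum TYPE(bool) J A S \<phi>"
    and "ba_completion S T"
  shows "dhc_sum TYPE('t) J A \<rho> T (sum_contact J A \<rho> T \<phi>) \<phi>"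
proof -
  interpret completed_free_product J A \<rho> S T \<phi>
    by (intro completed_free_product.intro assms)
  show ?thesis by (rule sum_setting.dhc_sum_contact[OF sum_setting])
qed

end
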